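(* Let $0<q<1$. Let $p\ge0$, $j\ge0$ and $N\ge1$ be integers (with $p\ge1$ in the last formula of (ii)). The following hold. (i) (Positive sum formula) $$\widehat{\mathfrak m}_{2p,j}=\sum_{l=0}^{p} q^{(j-l)(2p-l)+l(l-1)/2}\begin{bmatrix} j\\ l\end{bmatrix}_q\frac{[2p]_q!}{[2p-2l]_q!!\,[l]_q!},$$ $$\widehat m_{N,2p}=\sum_{j=0}^{N-1}\sum_{l=0}^{p} q^{(j-l)(2p-l)+l(l-1)/2}\begin{bmatrix} j\\ l\end{bmatrix}_q\frac{[2p]_q!}{[2p-2l]_q!!\,[l]_q!}.$$ Taking $q\to1$, these reduce respectively to the formulas $$(2p-1)!!\sum_{l=0}^p\binom{j}{l}\binom{p}{l}2^l,\qquad (2p-1)!!\sum_{l=0}^p\binom{N}{l+1}\binom{p}{l}2^l$$ for the spectral moments $\mathfrak m^{(\mathrm H)}_{2p,j}$ and $m^{(\mathrm H)}_{N,2p}$ of the Gaussian unitary ensemble. (ii) (Alternating sum formula) $$\widehat{\mathfrak m}_{2p,j}=[2p-1]_q!!\sum_{r=0}^{p}(-1)^r q^{r(r-1)}\begin{bmatrix} j+2p-2r\\ 2p\end{bmatrix}_q\begin{bmatrix} p\\ r\end{bmatrix}_{q^2},$$ $$\widehat m_{N,2p}=[2p-1]_q!!\sum_{r=0}^{p-1}(-1)^r q^{r(r+1)}\left(\begin{bmatrix} N+2p-2r-1\\ 2p\end{bmatrix}_q+\begin{bmatrix} N+2p-2r-2\\ 2p\end{bmatrix}_q\right)\begin{bmatrix}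 p-1\\ r\end{bmatrix}_{q^2}.$$ Taking $q\to1$, these reduce respectively to the formulas $$(2p-1)!!\sum_{r=0}^{p}(-1)^r\binom{j+2p-2r}{2p}\binom{p}{r},$$ $$(2p-1)!!\sum_{r=0}^{p-1}(-1)^r\left[\binom{N+2p-2r-1}{2p}+\binom{N+2p-2r-2}{2p}\right]\binom{p-1}{r}$$ for the same moments $\mathfrak m^{(\mathrm H)}_{2p,j}$ and $m^{(\mathrm H)}_{N,2p}$ of the Gaussian unitary ensemble.
   Context: Notation. For $n\ge0$: $(a;q)_n=\prod_{i=0}^{n-1}(1-aq^i)$ and $(a_1,\dots,a_k;q)_\infty=\prod_{i\ge0}(1-a_1q^i)\cdots(1-a_kq^i)$. $[n]_q=\frac{1-q^n}{1-q}$, $[n]_q!=\prod_{i=1}^n[i]_q$, $[2n]_q!!=\prod_{i=1}^n[2i]_q$, $[2n-1]_q!!=\prod_{i=1}^n[2i-1]_q$ (empty products are $1$). The $q$-binomial coefficient is $\begin{bmatrix} n\\ k\end{bmatrix}_q=\frac{[n]_q!}{[k]_q!\,[n-k]_q!}$ for $0\le k\le n$, and $0$ for $k>n\ge0$; a subscript $q^2$ means that $q$ is replaced by $q^2$. $(2p-1)!!=\prod_{i=1}^p(2i-1)$. Jackson integral: for $\alpha>0$, $\int_{-\alpha}^{\alpha}f(x)\,d_qx=(1-q)\sum_{k=0}^\infty \alpha q^k\big(f(\alpha q^k)+f(-\alpha q^k)\big)$. Discrete $q$-Hermite weight: $\omega(x)=\frac{(qx,-qx;q)_\infty}{(q,-1,-q;q)_\infty}$,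 supported on the points $\pm q^k$, $k=0,1,2,\dots$. Discrete $q$-Hermite polynomials: the monic polynomials $H_n(x;q)$ with $H_0=1$, $H_1=x$, $xH_n(x;q)=H_{n+1}(x;q)+q^{n-1}(1-q^n)H_{n-1}(x;q)$ for $n\ge1$; they satisfy $\int_{-1}^1H_m(x;q)H_n(x;q)\,\omega(x)\,d_qx=(1-q)(q;q)_nq^{n(n-1)/2}\delta_{mn}$. Spectral moments of the discrete $q$-deformed GUE: $$\mathfrak m_{2p,j}=\int_{-1}^1\frac{|x|^{2p}H_j(x;q)^2\,\omega(x)}{(1-q)(q;q)_j\,q^{j(j-1)/2}}\,d_qx,\qquad \widehat{\mathfrak m}_{2p,j}=\frac{\mathfrak m_{2p,j}}{(1-q)^p},\qquad \widehat m_{N,2p}=\sum_{j=0}^{N-1}\widehat{\mathfrak m}_{2p,j}.$$ The GUE spectral moments are $\mathfrak m^{(\mathrm H)}_{2p,j}=\int_{\mathbb R}x^{2p}\frac{He_j(x)^2}{j!}\frac{e^{-x^2/2}}{\sqrt{2\pi}}\,dx$ and $m^{(\mathrm H)}_{N,2p}=\sum_{j=0}^{N-1}\mathfrak m^{(\mathrm H)}_{2p,j}$, where $He_j$ is the monic Hermite polynomial of degree $j$, orthogonal with respect to $e^{-x^2/2}$. *)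

theory Defs
  imports "HOL-Analysis.Analysis" "HOL-Computational_Algebra.Polynomial"
begin

definition qpoch :: "real \<Rightarrow> real \<Rightarrow> nat \<Rightarrow> real" where
  "qpoch q a n = (\<Prod>i<n. 1 - a * q ^ i)"

definition qpoch_inf :: "real \<Rightarrow> real \<Rightarrow> real" where
  "qpoch_inf q a = (\<Prod>i. 1 - a * q ^ i)"

definition qnum :: "real \<Rightarrow> nat \<Rightarrow> real" where
  "qnum q n = (1 - q ^ n) / (1 - q)"

definition qfact :: "real \<Rightarrow> nat \<Rightarrow> real" where
  "qfact q n = (\<Prod>i=1..n. qnum q i)"

(* qdfact_even q n is [2n]_q!! and qdfact_odd q n is [2n-1]_q!!; likewise dfact_odd n is (2n-1)!!. *)

definition qdfact_even :: "real \<Rightarrow> nat \<Rightarrow> real" where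
  "qdfact_even q n = (\<Prod>i=1..n. qnum q (2 * i))"

definition qdfact_odd :: "real \<Rightarrow> nat \<Rightarrow> real" where
  "qdfact_odd q n = (\<Prod>i=1..n. qnum q (2 * i - 1))"

definition dfact_odd :: "nat \<Rightarrow> nat" where
  "dfact_odd n = (\<Prod>i=1..n. 2 * i - 1)"

definition qbinom :: "real \<Rightarrow> nat \<Rightarrow> nat \<Rightarrow> real" where
  "qbinom q n k = (if k \<le> n then qfact q n / (qfact q k * qfact q (n - k)) else 0)"

(* The Jackson integral over the symmetric interval from -\<alpha> to \<alpha>, for \<alpha> > 0. *)
definition jackson_integral :: "real \<Rightarrow> real \<Rightarrow> (real \<Rightarrow> real) \<Rightarrow> real" where
  "jackson_integral q \<alpha> f =
     (1 - q) * (\<Sum>k. \<alpha> * q ^ k * (f (\<alpha> * q ^ k) + f (- (\<alpha> * q ^ k))))"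

(* The discrete q-Hermite weight. Only its values at the points q^k and -q^k enter the
   Jackson integral over [-1,1], so the formula is not cut off outside this set. *)
definition dqH_weight :: "real \<Rightarrow> real \<Rightarrow> real" where
  "dqH_weight q x =
     (qpoch_inf q (q * x) * qpoch_inf q (- (q * x))) /
     (qpoch_inf q q * qpoch_inf q (- 1) * qpoch_inf q (- q))"

(* The recurrence x H_n = H_(n+1) + q^(n-1) (1 - q^n) H_(n-1), solved for H_(n+1) with n replaced by n+1. *)
fun dqHermite :: "real \<Rightarrow> nat \<Rightarrow> real poly" where
  "dqHermite q 0 = 1"
| "dqHermite q (Suc 0) = [:0, 1:]"
| "dqHermite q (Suc (Suc n)) =
     [:0, 1:] * dqHermite q (Suc n) - smult (q ^ n * (1 - q ^ Suc n)) (dqHermite q n)"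

(* The spectral moments m_(2p,j) of the discrete q-deformed GUE; the argument p stands for the order 2p. *)
definition dq_moment :: "real \<Rightarrow> nat \<Rightarrow> nat \<Rightarrow> real" where
  "dq_moment q p j =
     jackson_integral q 1
       (\<lambda>x. \<bar>x\<bar> ^ (2 * p) * (poly (dqHermite q j) x)\<^sup>2 * dqH_weight q x /
            ((1 - q) * qpoch q q j * q ^ (j * (j - 1) div 2)))"

definition dq_moment_hat :: "real \<Rightarrow> nat \<Rightarrow> nat \<Rightarrow> real" where
  "dq_moment_hat q p j = dq_moment q p j / (1 - q) ^ p"

definition dq_moment_hat_sum :: "real \<Rightarrow> nat \<Rightarrow> nat \<Rightarrow> real" where
  "dq_moment_hat_sum q N p = (\<Sum>j<N. dq_moment_hat q p j)"

(* The monic Hermite polynomials are determined uniquely by orthogonality with respect to exp (-x^2/2). *)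
definition is_monic_Hermite :: "(nat \<Rightarrow> real poly) \<Rightarrow> bool" where
  "is_monic_Hermite P \<longleftrightarrow>
     (\<forall>n. degree (P n) = n \<and> lead_coeff (P n) = 1) \<and>
     (\<forall>m n. m \<noteq> n \<longrightarrow>
        (LINT x|lborel. poly (P m) x * poly (P n) x * exp (- (x\<^sup>2) / 2)) = 0)"

definition He :: "nat \<Rightarrow> real poly" where
  "He = (THE P. is_monic_Hermite P)"

definition gue_moment :: "nat \<Rightarrow> nat \<Rightarrow> real" where
  "gue_moment p j =
     (LINT x|lborel. x ^ (2 * p) * ((poly (He j) x)\<^sup>2 / fact j) *
                     (exp (- (x\<^sup>2) / 2) / sqrt (2 * pi)))"

definition gue_moment_sum :: "nat \<Rightarrow> nat \<Rightarrow> real" where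
  "gue_moment_sum N p = (\<Sum>j<N. gue_moment p j)"

end

theory Submission
  imports Defs "HOL-Probability.Distributions" "HOL-Computational_Algebra.Formal_Power_Series"
begin

text \<open>
  Multiplication by X splits into a raising and a lowering operator on the discrete q-Hermite
  polynomials, and normal ordering of a power of X gives all matrix elements of that power in
  closed form; the diagonal ones, weighted by the orthogonality relation, are the positive sum.
  Orthogonality needs only the moment recurrence L(x^(n+2)) = c [n+1] L(x^n), which the weight
  satisfies by its functional equation (c = 1 - q) and the Gaussian by its known moments
  (q = c = 1), so both ensembles are covered by the same argument and the limit q -> 1 is
  continuity of a finite sum. The positive and the alternating sum have the same generating
  function in j, by the q-Vandermonde and the q-binomial theorem.
\<close>

section \<open>The positive and the alternating sum\<close>

text \<open>Summed over j with z^j, either sum gives [2p-1]!! (z^2;q^2)_p / (z;q)_(2p+1). The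
  q-identities behind this are applied with power series as arguments, so q-binomials and finite
  q-products are set up over any commutative ring and without division; in this form
  \<open>q = 1\<close> may be substituted as well. The raising operator U and the lowering operator
  D satisfy D U - q U D = c K^2 with K H_n = q^n H_n, together with K^2 U = q^2 U K^2 and D K^2 =
  q^2 K^2 D. The q-commutator is thus not a scalar, and normal ordering needs a third factor: m
  contractions contribute K^(2m) and the denominator [2m]!!. For q = 1 the operator K is the
  identity and the expansion becomes Wick's.\<close>

text \<open>In contrast to qnum, which is 0 / 0 at q = 1, this is continuous in q.\<close>

definition qint :: "'a::comm_ring_1 \<Rightarrow> nat \<Rightarrow> 'a" where
  "qint q n = (\<Sum>i<n. q ^ i)"

definition qfac :: "'a::comm_ring_1 \<Rightarrow> nat \<Rightarrow> 'a" where
  "qfac q n = (\<Prod>i=1..n. qint q i)"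

definition qdfac_even :: "'a::comm_ring_1 \<Rightarrow> nat \<Rightarrow> 'a" where
  "qdfac_even q n = (\<Prod>i=1..n. qint q (2 * i))"

definition qdfac_odd :: "'a::comm_ring_1 \<Rightarrow> nat \<Rightarrow> 'a" where
  "qdfac_odd q n = (\<Prod>i=1..n. qint q (2 * i - 1))"

fun gbin :: "'a::comm_ring_1 \<Rightarrow> nat \<Rightarrow> nat \<Rightarrow> 'a" where
  "gbin q n 0 = 1"
| "gbin q 0 (Suc k) = 0"
| "gbin q (Suc n) (Suc k) = gbin q n k + q ^ Suc k * gbin q n (Suc k)"

definition qprod :: "'a::comm_ring_1 \<Rightarrow> 'a \<Rightarrow> nat \<Rightarrow> 'a" where
  "qprod q a n = (\<Prod>i<n. 1 - a * q ^ i)"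

section \<open>q-integers and q-factorials\<close>

lemma qint_0 [simp]: "qint q 0 = 0"
  by (simp add: qint_def)

lemma qint_add: "qint q (m + n) = qint q m + q ^ m * qint q n"
  by (induction n) (simp_all add: qint_def power_add algebra_simps)

lemma qint_pos: "qint q n > 0" if "q > 0" "n > 0" for q :: real
  using that unfolding qint_def by (intro sum_pos) auto

lemma qint_one: "qint (1::'a::comm_ring_1) n = of_nat n"
  by (simp add: qint_def)

lemma qnum_eq_qint: "qnum q n = qint q n" if "q \<noteq> 1"
  using that sum_gp_strict[of q n] by (simp add: qnum_def qint_def)

lemma qint_double: "qint q (2 * n) = qint q n * (1 + q ^ n)"
  unfolding mult_2 qint_add by (simp add: algebra_simps)

lemma qfac_0 [simp]: "qfac q 0 = 1"
  by (simp add: qfac_def)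

lemma qfac_Suc [simp]: "qfac q (Suc n) = qfac q n * qint q (Suc n)"
  by (simp add: qfac_def)

lemma qdfac_even_0 [simp]: "qdfac_even q 0 = 1"
  by (simp add: qdfac_even_def)

lemma qdfac_even_Suc [simp]: "qdfac_even q (Suc n) = qdfac_even q n * qint q (2 * Suc n)"
  by (simp add: qdfac_even_def)

lemma qdfac_odd_0 [simp]: "qdfac_odd q 0 = 1"
  by (simp add: qdfac_odd_def)

lemma qdfac_odd_Suc [simp]: "qdfac_odd q (Suc n) = qdfac_odd q n * qint q (Suc (2 * n))"
  by (simp add: qdfac_odd_def)

lemma qfac_pos: "qfac q n > 0" if "q > 0" for q :: real
  by (induction n) (use that in \<open>simp_all add: qint_pos\<close>)

lemma qdfac_even_pos: "qdfac_even q n > 0" if "q > 0" for q :: real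
  by (induction n) (use that in \<open>simp_all add: qint_pos\<close>)

lemma qfac_double: "qfac q (2 * n) = qdfac_even q n * qdfac_odd q n"
  by (induction n) (simp_all add: algebra_simps)

lemma qfact_eq_qfac: "q \<noteq> 1 \<Longrightarrow> qfact q n = qfac q n"
  by (simp add: qfact_def qfac_def qnum_eq_qint)

lemma qdfact_even_eq_qdfac_even: "q \<noteq> 1 \<Longrightarrow> qdfact_even q n = qdfac_even q n"
  by (simp add: qdfact_even_def qdfac_even_def qnum_eq_qint)

lemma qdfact_odd_eq_qdfac_odd: "q \<noteq> 1 \<Longrightarrow> qdfact_odd q n = qdfac_odd q n"
  by (simp add: qdfact_odd_def qdfac_odd_def qnum_eq_qint)

section \<open>q-binomial coefficients\<close>

lemma gbin_eq_0: "n < k \<Longrightarrow> gbin q n k = 0"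
  by (induction q n k rule: gbin.induct) auto

lemma gbin_self [simp]: "gbin q n n = 1"
  by (induction n) (simp_all add: gbin_eq_0)

text \<open>The Pascal rule mirrored under k -> n - k. Without division the symmetry is not at hand,
  so the induction expands the upper row by the defining rule and regroups two instances of the
  hypothesis. Writing n as \<open>d + k\<close> avoids truncated subtraction.\<close>

lemma gbin_Suc_Suc': "gbin q (Suc (d + k)) (Suc k) = q ^ d * gbin q (d + k) k + gbin q (d + k) (Suc k)"
proof (induction "d + k" arbitrary: d k)
  case 0
  then show ?case by simp
next
  case (Suc n)
  note IH = Suc.hyps(1)
  show ?case
  proof (cases d)
    case 0
    then show ?thesis by (simp add: gbin_eq_0)
  next
    case [simp]: (Suc e)
    have n: "n = e + k" using Suc.hyps(2) by simp
    have 1: "gbin q (Suc n) (Suc k) = q ^ e * gbin q n k + gbin q n (Suc k)"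
      using IH[OF n] by (simp add: n)
    have e: "q ^ k * q ^ e = q ^ n" by (simp add: n power_add)
    show ?thesis
    proof (cases k)
      case 0
      then have n': "n = e" using n by simp
      have "gbin q (Suc (Suc n)) (Suc 0) = 1 + q * gbin q (Suc n) (Suc 0)"
        by simp
      also have "\<dots> = 1 + q * (q ^ e + gbin q n (Suc 0))"
        using 1 0 by simp
      also have "\<dots> = q ^ d + gbin q (Suc n) (Suc 0)"
        by (simp add: algebra_simps)
      finally show ?thesis using 0 n' by simp
    next
      case [simp]: (Suc k')
      have n2: "n = Suc e + k'" using n by simp
      have 2: "gbin q (Suc n) k = q ^ d * gbin q n k' + gbin q n k"
        using IH[OF n2] by (simp add: n)
      have "gbin q (Suc (Suc n)) (Suc k) = gbin q (Suc n) k + q ^ Suc k * gbin q (Suc n) (Suc k)"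
        by simp
      also have "\<dots> = q ^ d * gbin q n k' + gbin q n k
          + q ^ Suc k * (q ^ e * gbin q n k + gbin q n (Suc k))"
        by (simp only: 1 2)
      also have "\<dots> = q ^ d * (gbin q n k' + q ^ k * gbin q n k)
          + (gbin q n k + q ^ Suc k * gbin q n (Suc k))"
        by (simp add: algebra_simps)
      also have "\<dots> = q ^ d * gbin q (Suc n) k + gbin q (Suc n) (Suc k)"
        by simp
      finally show ?thesis by (simp add: n)
    qed
  qed
qed

text \<open>Ties the Pascal recursion to the factorial quotient without dividing. The step splits
  [n+1] = [k+1] + q^(k+1) [n-k]; k = n is separate because the second binomial is 0 there.\<close>

lemma gbin_qfac: "k \<le> n \<Longrightarrow> gbin q n k * qfac q k * qfac q (n - k) = qfac q n"
proof (induction q n k rule: gbin.induct)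
  case (3 q n k)
  show ?case
  proof (cases "k = n")
    case True
    then show ?thesis by (simp add: gbin_eq_0)
  next
    case False
    then obtain d where n: "n = Suc (k + d)"
      using 3 less_imp_Suc_add[of k n] by auto
    have 1: "gbin q n k * qfac q k * (qfac q d * qint q (Suc d)) = qfac q n"
      using 3 n by (simp add: Suc_diff_le)
    have 2: "gbin q n (Suc k) * (qfac q k * qint q (Suc k)) * qfac q d = qfac q n"
      using 3 n by simp
    have "qint q (Suc n) = qint q (Suc k) + q ^ Suc k * qint q (Suc d)"
      using qint_add[of q "Suc k" "Suc d"] n by simp
    then have "qfac q (Suc n) = qfac q n * qint q (Suc k) + q ^ Suc k * (qfac q n * qint q (Suc d))"
      by (simp add: algebra_simps)
    also have "\<dots> = gbin q n k * qfac q k * (qfac q d * qint q (Suc d)) * qint q (Suc k)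
       + q ^ Suc k * (gbin q n (Suc k) * (qfac q k * qint q (Suc k)) * qfac q d * qint q (Suc d))"
      by (simp only: 1 2)
    also have "\<dots> = gbin q (Suc n) (Suc k) * qfac q (Suc k) * qfac q (Suc n - Suc k)"
      using n by (simp add: algebra_simps)
    finally show ?thesis by simp
  qed
qed simp_all

lemma qbinom_eq_gbin: "qbinom q n k = gbin q n k" if "0 < q" "q \<noteq> 1"
proof (cases "k \<le> n")
  case True
  have "qfac q k \<noteq> 0" "qfac q (n - k) \<noteq> 0"
    using qfac_pos[OF that(1), of k] qfac_pos[OF that(1), of "n - k"] by simp_all
  then show ?thesis
    using True that gbin_qfac[OF True, of q] by (simp add: qbinom_def qfact_eq_qfac field_simps)
qed (simp add: qbinom_def gbin_eq_0)

lemma gbin_one: "gbin (1::'a::comm_ring_1) n k = of_nat (n choose k)"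
  by (induction "1::'a" n k rule: gbin.induct) simp_all

lemma gbin_fps_const: "gbin (fps_const q) n k = fps_const (gbin q n k)"
  by (induction q n k rule: gbin.induct)
    (simp_all flip: fps_const_power fps_const_mult fps_const_add)

lemma gbin_Suc_right:
  fixes q :: real
  assumes "q > 0"
  shows "gbin q n (Suc k) * qint q (Suc k) = gbin q n k * qint q (n - k)"
proof (cases "k < n")
  case True
  have 1: "gbin q n (Suc k) * (qfac q k * qint q (Suc k)) * qfac q (n - Suc k) = qfac q n"
    using gbin_qfac[of "Suc k" n q] True by simp
  have "gbin q n k * qfac q k * (qfac q (n - Suc k) * qint q (n - k)) = qfac q n"
    using gbin_qfac[of k n q] True Suc_diff_Suc[OF True] qfac_Suc[of q "n - Suc k"] by simp
  with 1 have "(qfac q k * qfac q (n - Suc k)) * (gbin q n (Suc k) * qint q (Suc k))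
    = (qfac q k * qfac q (n - Suc k)) * (gbin q n k * qint q (n - k))"
    by (simp add: mult_ac)
  then show ?thesis
    using qfac_pos[OF assms, of k] qfac_pos[OF assms, of "n - Suc k"] by simp
qed (simp add: gbin_eq_0)

section \<open>q-Vandermonde and the q-binomial theorem\<close>

lemma qprod_0 [simp]: "qprod q a 0 = 1"
  by (simp add: qprod_def)

lemma qprod_Suc [simp]: "qprod q a (Suc n) = qprod q a n * (1 - a * q ^ n)"
  by (simp add: qprod_def)

lemma qprod_add: "qprod q a (m + n) = qprod q a m * qprod q (a * q ^ m) n"
  by (induction n) (simp_all add: power_add mult_ac)

lemma qprod_mult_uminus: "qprod q a n * qprod q (- a) n = qprod (q\<^sup>2) (a\<^sup>2) n"
proof (induction n)
  case (Suc n)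
  have "qprod q a (Suc n) * qprod q (- a) (Suc n)
    = qprod q a n * qprod q (- a) n * ((1 - a * q ^ n) * (1 + a * q ^ n))"
    by (simp add: mult_ac)
  also have "(1 - a * q ^ n) * (1 + a * q ^ n) = 1 - a\<^sup>2 * (q\<^sup>2) ^ n"
    by (simp add: algebra_simps power2_eq_square power_mult_distrib)
  finally show ?case by (simp add: Suc.IH)
qed simp

text \<open>The new factor 1 - a b q^n is split, in each summand differently, so that one part
  lengthens the product in \<open>b\<close> and the other the product in \<open>a\<close>; the
  mirrored Pascal rule \<open>gbin_Suc_Suc'\<close> then merges the two sums.\<close>

lemma q_vandermonde:
  "qprod q (a * b) n = (\<Sum>k\<le>n. gbin q n k * b ^ k * qprod q a k * qprod q b (n - k))"
proof (induction n)
  case (Suc n)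
  define f where "f n k = gbin q n k * b ^ k * qprod q a k * qprod q b (n - k)" for n k
  define g where "g k = q ^ (n - k) * gbin q n k * b ^ Suc k * qprod q a (Suc k) * qprod q b (n - k)" for k
  define h where "h k = gbin q n k * b ^ k * qprod q a k * qprod q b (Suc n - k)" for k
  have "qprod q (a * b) (Suc n) = (\<Sum>k\<le>n. f n k) * (1 - a * b * q ^ n)"
    using Suc.IH by (simp add: f_def)
  also have "\<dots> = (\<Sum>k\<le>n. h k + g k)"
    unfolding sum_distrib_right
  proof (intro sum.cong refl)
    fix k assume "k \<in> {..n}"
    then obtain d where n: "n = k + d" using le_iff_add by auto
    have split: "1 - a * b * q ^ n = (1 - b * q ^ d) + b * q ^ d * (1 - a * q ^ k)"
      by (simp add: n power_add algebra_simps)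
    show "f n k * (1 - a * b * q ^ n) = h k + g k"
      unfolding split by (simp add: f_def h_def g_def n Suc_diff_le algebra_simps)
  qed
  also have "\<dots> = (\<Sum>k\<le>Suc n. h k) + (\<Sum>k\<le>n. g k)"
    by (simp add: sum.distrib h_def gbin_eq_0)
  also have "\<dots> = h 0 + (\<Sum>k\<le>n. h (Suc k) + g k)"
    by (simp add: sum.distrib sum.atMost_Suc_shift del: sum.atMost_Suc)
  also have "\<dots> = f (Suc n) 0 + (\<Sum>k\<le>n. f (Suc n) (Suc k))"
  proof (intro arg_cong2[of _ _ _ _ "(+)"] sum.cong refl)
    fix k assume "k \<in> {..n}"
    then have "gbin q (Suc n) (Suc k) = q ^ (n - k) * gbin q n k + gbin q n (Suc k)"
      using gbin_Suc_Suc'[of q "n - k" k] by simp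
    then show "h (Suc k) + g k = f (Suc n) (Suc k)"
      unfolding h_def g_def f_def by (simp add: algebra_simps del: gbin.simps)
  qed (simp add: h_def f_def)
  also have "\<dots> = (\<Sum>k\<le>Suc n. f (Suc n) k)"
    by (simp add: sum.atMost_Suc_shift del: sum.atMost_Suc)
  finally show ?case by (simp add: f_def del: sum.atMost_Suc qprod_Suc gbin.simps)
qed simp

lemma triangle_Suc: "Suc k * k div 2 = k * (k - 1) div 2 + k"
proof (cases k)
  case (Suc m)
  have "Suc k * k = k * (k - 1) + k * 2" by (simp add: Suc)
  then show ?thesis by (simp only: div_mult_self1)
qed simp

lemma q_binomial_theorem:
  "qprod q a n = (\<Sum>k\<le>n. (- 1) ^ k * q ^ (k * (k - 1) div 2) * gbin q n k * a ^ k)"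
proof (induction n arbitrary: a)
  case (Suc n)
  define t where "t k = (- 1) ^ k * q ^ (k * (k - 1) div 2) * gbin q n k * (a * q) ^ k" for k
  have t: "t (Suc n) = 0" by (simp add: t_def gbin_eq_0)
  \<comment> \<open>The first factor is split off, not the last: the hypothesis at
    \<open>a * q\<close> supplies the power q^k that the defining Pascal rule needs, hence the
    generalization over \<open>a\<close>.\<close>
  have 1: "qprod q a (Suc n) = (1 - a) * (\<Sum>k\<le>n. t k)"
    using qprod_add[of q a 1 n] Suc.IH[of "a * q"] by (simp add: t_def)
  also have "\<dots> = (\<Sum>k\<le>Suc n. t k) - (\<Sum>k\<le>n. a * t k)"
    by (simp add: t left_diff_distrib sum_distrib_left sum_subtractf)
  also have "\<dots> = t 0 + (\<Sum>k\<le>n. t (Suc k) - a * t k)"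
    unfolding sum.atMost_Suc_shift sum_subtractf by simp
  also have "\<dots> = 1 + (\<Sum>k\<le>n. (- 1) ^ Suc k * q ^ (Suc k * k div 2) * gbin q (Suc n) (Suc k) * a ^ Suc k)"
  proof (intro arg_cong2[of _ _ _ _ "(+)"] sum.cong refl)
    fix k
    show "t (Suc k) - a * t k
      = (- 1) ^ Suc k * q ^ (Suc k * k div 2) * gbin q (Suc n) (Suc k) * a ^ Suc k"
      unfolding t_def diff_Suc_1 triangle_Suc by (simp add: algebra_simps power_add power_mult_distrib)
  qed (simp add: t_def)
  also have "\<dots> = (\<Sum>k\<le>Suc n. (- 1) ^ k * q ^ (k * (k - 1) div 2) * gbin q (Suc n) k * a ^ k)"
    unfolding sum.atMost_Suc_shift by simp
  finally show ?case .
qed simp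

section \<open>Generating functions in j\<close>

definition positive_sum :: "real \<Rightarrow> nat \<Rightarrow> nat \<Rightarrow> real" where
  "positive_sum q p j = (\<Sum>l\<le>p. q ^ ((j - l) * (2 * p - l) + l * (l - 1) div 2) * gbin q j l *
     (qfac q (2 * p) / (qdfac_even q (p - l) * qfac q l)))"

definition alternating_sum :: "real \<Rightarrow> nat \<Rightarrow> nat \<Rightarrow> real" where
  "alternating_sum q p j = qdfac_odd q p * (\<Sum>r\<le>p. (- 1) ^ r * q ^ (r * (r - 1)) *
     gbin q (j + 2 * p - 2 * r) (2 * p) * gbin (q\<^sup>2) p r)"

text \<open>The parameter \<open>b\<close> absorbs the j-dependent power q^((j-l)(2p-l)) of the
  positive sum. One Pascal step amounts to multiplication by z / (1 - b z q^(l+1)). For j < l the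
  truncated exponent is harmless, since the coefficient is 0.\<close>

lemma gbin_genfun:
  "Abs_fps (\<lambda>j. gbin q j l * b ^ (j - l)) * qprod (fps_const q) (fps_const b * fps_X) (Suc l) = fps_X ^ l"
  (is "?g l * _ = _")
proof (induction l)
  case 0
  show ?case
  proof (rule fps_ext)
    fix n show "fps_nth (?g 0 * qprod (fps_const q) (fps_const b * fps_X) (Suc 0)) n = fps_nth (fps_X ^ 0) n"
      by (cases n) (simp_all add: algebra_simps)
  qed
next
  case (Suc l)
  have "?g (Suc l) * (1 - fps_const b * fps_X * fps_const q ^ Suc l) = fps_X * ?g l"
  proof (rule fps_ext)
    fix n
    have *: "?g (Suc l) * (1 - fps_const b * fps_X * fps_const q ^ Suc l)
      = ?g (Suc l) - fps_const (b * q ^ Suc l) * (fps_X * ?g (Suc l))"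
      by (simp add: algebra_simps flip: fps_const_power fps_const_mult)
    show "fps_nth (?g (Suc l) * (1 - fps_const b * fps_X * fps_const q ^ Suc l)) n = fps_nth (fps_X * ?g l) n"
    proof (cases n)
      case 0
      then show ?thesis by (simp add: *)
    next
      case (Suc j)
      show ?thesis
      proof (cases "l < j")
        case True
        then have "j - l = Suc (j - Suc l)" by simp
        then show ?thesis using Suc by (simp add: * algebra_simps)
      next
        case False
        then show ?thesis unfolding * using Suc by (cases "j = l") (auto simp: gbin_eq_0)
      qed
    qed
  qed
  then have "qprod (fps_const q) (fps_const b * fps_X) (Suc l) *
      (?g (Suc l) * (1 - fps_const b * fps_X * fps_const q ^ Suc l))
    = fps_X * (?g l * qprod (fps_const q) (fps_const b * fps_X) (Suc l))"
    by (simp only: mult_ac)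
  then show ?case
    unfolding Suc.IH qprod_Suc[of _ _ "Suc l"] by (simp only: mult_ac power_Suc)
qed

text \<open>Brings the l-th weight into the shape of q-Vandermonde with a = -q^(-p). Each even
  factor leaving [2p]!! splits as [2i] = [i] (1 + q^i): the parts [i] build the binomial
  coefficient, the parts 1 + q^i, after a power of q is pulled out, the product in a.\<close>

lemma q_power_triangle_qdfac:
  fixes q :: real
  assumes "q > 0" "l \<le> p"
  shows "q ^ (l * (l - 1) div 2) * qdfac_even q p
    = qdfac_even q (p - l) * qfac q l * gbin q p l * (q ^ p) ^ l * qprod q (- inverse (q ^ p)) l"
  using assms(2)
proof (induction l)
  case (Suc l)
  have 1: "q ^ l * (1 + q ^ (p - l)) = q ^ p * (1 + inverse (q ^ p) * q ^ l)"
    using Suc.prems \<open>q > 0\<close> by (simp add: algebra_simps flip: power_add)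
  have "p - l = Suc (p - Suc l)" using Suc.prems by simp
  then have 2: "qdfac_even q (p - l) = qdfac_even q (p - Suc l) * (qint q (p - l) * (1 + q ^ (p - l)))"
    using qdfac_even_Suc[of q "p - Suc l"] qint_double[of q "p - l"] by simp
  have "q ^ (Suc l * (Suc l - 1) div 2) * qdfac_even q p
    = q ^ (l * (l - 1) div 2) * qdfac_even q p * q ^ l"
    unfolding diff_Suc_1 triangle_Suc by (simp add: power_add)
  also have "\<dots> = qdfac_even q (p - l) * qfac q l * gbin q p l * (q ^ p) ^ l
      * qprod q (- inverse (q ^ p)) l * q ^ l"
    using Suc by simp
  also have "\<dots> = qdfac_even q (p - Suc l) * qfac q l * (gbin q p l * qint q (p - l)) * (q ^ p) ^ l
      * qprod q (- inverse (q ^ p)) l * (q ^ l * (1 + q ^ (p - l)))"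
    unfolding 2 by (simp only: mult_ac)
  also have "\<dots> = qdfac_even q (p - Suc l) * qfac q (Suc l) * gbin q p (Suc l) * (q ^ p) ^ Suc l
      * qprod q (- inverse (q ^ p)) (Suc l)"
    unfolding 1 gbin_Suc_right[OF \<open>q > 0\<close>, symmetric] by (simp add: mult_ac)
  finally show ?case .
qed simp

lemma qprod_fps_const: "qprod (fps_const q) (fps_const a) n = fps_const (qprod q a n)"
  by (induction n) (simp_all flip: fps_const_mult fps_const_sub add: fps_const_power)

text \<open>The product (z;q)_(2p+1) is cut at 2p - l. Its tail cancels by
  \<open>gbin_genfun\<close> with b = q^(2p-l), and its head contains (z;q)_p for every l. What
  remains is q-Vandermonde with a = -q^(-p) and b = z q^p.\<close>

lemma positive_sum_genfun:
  assumes "q > 0"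
  shows "Abs_fps (positive_sum q p) * qprod (fps_const q) fps_X (Suc (2 * p))
    = fps_const (qdfac_odd q p) * qprod (fps_const q ^ 2) (fps_X ^ 2) p"
proof -
  define c where "c l = q ^ (l * (l - 1) div 2) * (qfac q (2 * p) / (qdfac_even q (p - l) * qfac q l))" for l
  define g where "g l = Abs_fps (\<lambda>j. gbin q j l * (q ^ (2 * p - l)) ^ (j - l))" for l
  let ?Q = "fps_const q"
  let ?a = "fps_const (- inverse (q ^ p))"
  let ?b = "fps_X * ?Q ^ p"
  have "Abs_fps (positive_sum q p) = (\<Sum>l\<le>p. fps_const (c l) * g l)"
    by (rule fps_ext)
      (simp add: fps_sum_nth positive_sum_def c_def g_def power_add mult_ac flip: power_mult)
  then have "Abs_fps (positive_sum q p) * qprod ?Q fps_X (Suc (2 * p))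
    = (\<Sum>l\<le>p. fps_const (c l) * g l * qprod ?Q fps_X (Suc (2 * p)))"
    by (simp only: sum_distrib_right)
  also have "\<dots> = (\<Sum>l\<le>p. fps_const (qdfac_odd q p) * qprod ?Q fps_X p *
      (gbin ?Q p l * ?b ^ l * qprod ?Q ?a l * qprod ?Q ?b (p - l)))"
  proof (intro sum.cong refl)
    fix l assume "l \<in> {..p}"
    then have l: "l \<le> p" by simp
    have "2 * p - l + Suc l = Suc (2 * p)" using l by simp
    then have "qprod ?Q fps_X (Suc (2 * p))
      = qprod ?Q fps_X (2 * p - l) * qprod ?Q (fps_const (q ^ (2 * p - l)) * fps_X) (Suc l)"
      using qprod_add[of ?Q fps_X "2 * p - l" "Suc l"] by (simp only: fps_const_power mult.commute)
    then have 1: "g l * qprod ?Q fps_X (Suc (2 * p)) = qprod ?Q fps_X (2 * p - l) * fps_X ^ l"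
      unfolding g_def by (simp only: mult.left_commute[of "Abs_fps _"] gbin_genfun)
    have 2: "qprod ?Q fps_X (2 * p - l) = qprod ?Q fps_X p * qprod ?Q ?b (p - l)"
      using qprod_add[of ?Q fps_X p "p - l"] l by (simp add: mult_2)
    have "c l = qdfac_odd q p * gbin q p l * (q ^ p) ^ l * qprod q (- inverse (q ^ p)) l"
      using q_power_triangle_qdfac[OF assms l] qdfac_even_pos[OF assms, of "p - l"] qfac_pos[OF assms, of l]
      unfolding c_def qfac_double by (simp add: field_simps)
    then have 3: "fps_const (c l) = fps_const (qdfac_odd q p) * gbin ?Q p l * (?Q ^ p) ^ l * qprod ?Q ?a l"
      by (simp only: gbin_fps_const qprod_fps_const fps_const_power fps_const_mult)
    show "fps_const (c l) * g l * qprod ?Q fps_X (Suc (2 * p)) = fps_const (qdfac_odd q p) * qprod ?Q fps_X p *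
      (gbin ?Q p l * ?b ^ l * qprod ?Q ?a l * qprod ?Q ?b (p - l))"
      unfolding mult.assoc[of _ "g l"] 1 2 3 by (simp only: power_mult_distrib mult_ac)
  qed
  also have "\<dots> = fps_const (qdfac_odd q p) * qprod ?Q fps_X p * qprod ?Q (?a * ?b) p"
    by (simp only: q_vandermonde sum_distrib_left)
  \<comment> \<open>The inverse power in a cancels against b, so (z;q)_p meets (-z;q)_p and the two
    combine to (z^2;q^2)_p.\<close>
  also have "?a * ?b = - fps_X"
  proof -
    have "?a * ?Q ^ p = - 1"
      using assms by (simp add: fps_const_power flip: fps_const_neg)
    then have "fps_X * (?a * ?Q ^ p) = - fps_X" by simp
    then show ?thesis by (simp only: mult.left_commute)
  qed
  finally show ?thesis by (simp only: mult.assoc qprod_mult_uminus)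
qed

text \<open>The q-binomial theorem in base q^2 expands (z^2;q^2)_p; each z^(2r) shifts the series of
  the q-binomials with lower index 2p, which is z^(2p) / (z;q)_(2p+1).\<close>

lemma alternating_sum_genfun:
  "Abs_fps (alternating_sum q p) * qprod (fps_const q) fps_X (Suc (2 * p))
    = fps_const (qdfac_odd q p) * qprod (fps_const q ^ 2) (fps_X ^ 2) p"
proof -
  define g where "g = Abs_fps (\<lambda>j. gbin q j (2 * p))"
  define c where "c r = (- 1) ^ r * q ^ (r * (r - 1)) * gbin (q\<^sup>2) p r" for r
  let ?Q = "fps_const q"
  have g: "g * qprod ?Q fps_X (Suc (2 * p)) = fps_X ^ (2 * p)"
    using gbin_genfun[of q "2 * p" 1] by (simp add: g_def)
  have "qprod (?Q ^ 2) (fps_X ^ 2) p = (\<Sum>r\<le>p. fps_const (c r) * fps_X ^ (2 * r))"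
    unfolding q_binomial_theorem
  proof (intro sum.cong refl)
    fix r :: nat
    have "even (r * (r - 1))" by auto
    then have "(?Q ^ 2) ^ (r * (r - 1) div 2) = fps_const (q ^ (r * (r - 1)))"
      by (simp only: fps_const_power dvd_mult_div_cancel flip: power_mult)
    moreover have "(- 1 :: real fps) ^ r = fps_const ((- 1) ^ r)"
      by (metis fps_const_1_eq_1 fps_const_neg fps_const_power)
    ultimately show "(- 1) ^ r * (?Q ^ 2) ^ (r * (r - 1) div 2) * gbin (?Q ^ 2) p r * (fps_X ^ 2) ^ r
      = fps_const (c r) * fps_X ^ (2 * r)"
      unfolding c_def by (simp only: fps_const_power gbin_fps_const fps_const_mult power_mult)
  qed
  moreover have "fps_X ^ (2 * p) * Abs_fps (alternating_sum q p)
    = fps_const (qdfac_odd q p) * (\<Sum>r\<le>p. fps_const (c r) * (fps_X ^ (2 * r) * g))"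
  proof (rule fps_ext)
    fix n
    show "fps_nth (fps_X ^ (2 * p) * Abs_fps (alternating_sum q p)) n
      = fps_nth (fps_const (qdfac_odd q p) * (\<Sum>r\<le>p. fps_const (c r) * (fps_X ^ (2 * r) * g))) n"
    proof (cases "2 * p \<le> n")
      case True
      have "fps_nth (\<Sum>r\<le>p. fps_const (c r) * (fps_X ^ (2 * r) * g)) n
        = (\<Sum>r\<le>p. c r * gbin q (n - 2 * r) (2 * p))"
        unfolding fps_sum_nth
      proof (intro sum.cong refl)
        fix r assume "r \<in> {..p}"
        then have "\<not> n < 2 * r" using True by auto
        then show "fps_nth (fps_const (c r) * (fps_X ^ (2 * r) * g)) n = c r * gbin q (n - 2 * r) (2 * p)"
          by (simp add: fps_X_power_mult_nth g_def)
      qed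
      moreover have "fps_nth (fps_X ^ (2 * p) * Abs_fps (alternating_sum q p)) n = alternating_sum q p (n - 2 * p)"
        using True by (simp add: fps_X_power_mult_nth not_less)
      ultimately show ?thesis
        using True by (simp add: alternating_sum_def c_def mult_ac)
    next
      case False
      then show ?thesis
        by (auto simp: fps_X_power_mult_nth fps_sum_nth g_def gbin_eq_0 intro!: sum.neutral)
    qed
  qed
  ultimately have "fps_X ^ (2 * p) * Abs_fps (alternating_sum q p)
    = fps_const (qdfac_odd q p) * (qprod (?Q ^ 2) (fps_X ^ 2) p * g)"
    by (simp add: sum_distrib_right mult.assoc)
  then have "fps_X ^ (2 * p) * (Abs_fps (alternating_sum q p) * qprod ?Q fps_X (Suc (2 * p)))
    = fps_const (qdfac_odd q p) * (qprod (?Q ^ 2) (fps_X ^ 2) p * g) * qprod ?Q fps_X (Suc (2 * p))"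
    by (simp only: mult.assoc[symmetric])
  also have "\<dots> = fps_const (qdfac_odd q p) * qprod (?Q ^ 2) (fps_X ^ 2) p * (g * qprod ?Q fps_X (Suc (2 * p)))"
    by (simp only: mult.assoc)
  also have "\<dots> = fps_X ^ (2 * p) * (fps_const (qdfac_odd q p) * qprod (?Q ^ 2) (fps_X ^ 2) p)"
    unfolding g by (simp only: mult_ac)
  finally have "fps_X ^ (2 * p) * (Abs_fps (alternating_sum q p) * qprod ?Q fps_X (Suc (2 * p)))
    = fps_X ^ (2 * p) * (fps_const (qdfac_odd q p) * qprod (?Q ^ 2) (fps_X ^ 2) p)" .
  then show ?thesis by simp
qed

lemma positive_sum_eq_alternating_sum:
  assumes "q > 0"
  shows "positive_sum q p j = alternating_sum q p j"
proof -
  \<comment> \<open>Constant term 1 makes the denominator a nonzero element of an integral domain,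
    so it cancels.\<close>
  have "fps_nth (qprod (fps_const q) fps_X n) 0 = 1" for n
    by (induction n) simp_all
  then have "qprod (fps_const q) fps_X (Suc (2 * p)) \<noteq> 0"
    by (metis fps_zero_nth zero_neq_one)
  moreover have "Abs_fps (positive_sum q p) * qprod (fps_const q) fps_X (Suc (2 * p))
      = Abs_fps (alternating_sum q p) * qprod (fps_const q) fps_X (Suc (2 * p))"
    using positive_sum_genfun[OF assms] alternating_sum_genfun by simp
  ultimately have "Abs_fps (positive_sum q p) = Abs_fps (alternating_sum q p)"
    by simp
  then show ?thesis
    by (metis fps_nth_Abs_fps)
qed

section \<open>Moments of a Hermite functional\<close>

text \<open>The family interpolates between dqHermite q (c = 1 - q) and the Hermite polynomials (q = c = 1).\<close>

fun qHermite :: "real \<Rightarrow> real \<Rightarrow> nat \<Rightarrow> real poly" where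
  "qHermite q c 0 = 1"
| "qHermite q c (Suc 0) = [:0, 1:]"
| "qHermite q c (Suc (Suc n)) =
     [:0, 1:] * qHermite q c (Suc n) - smult (c * q ^ n * qint q (Suc n)) (qHermite q c n)"

lemma one_minus_mult_qint: "(1 - q) * qint q n = 1 - q ^ n" for q :: real
  by (simp add: qint_def one_diff_power_eq)

lemma dqHermite_eq_qHermite: "dqHermite q n = qHermite q (1 - q) n"
proof (induction q n rule: dqHermite.induct)
  case (3 q n)
  have "q ^ n * (1 - q ^ Suc n) = (1 - q) * q ^ n * qint q (Suc n)"
    unfolding one_minus_mult_qint[symmetric] by simp
  then show ?case by (simp only: dqHermite.simps qHermite.simps 3)
qed simp_all

section \<open>Raising, lowering and normal ordering\<close>

lemma X_mult_qHermite:
  "[:0, 1:] * qHermite q c k = qHermite q c (Suc k) + smult (c * q ^ (k - 1) * qint q k) (qHermite q c (k - 1))"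
  \<comment> \<open>For \<open>k = 0\<close> the truncated index is harmless because
    \<open>qint q 0 = 0\<close>.\<close>
  by (cases k) simp_all

lemma degree_qHermite: "degree (qHermite q c n) = n" and lead_coeff_qHermite: "lead_coeff (qHermite q c n) = 1"
proof -
  have "degree (qHermite q c n) = n \<and> lead_coeff (qHermite q c n) = 1"
  proof (induction q c n rule: qHermite.induct)
    case (3 q c n)
    let ?f = "[:0, 1:] * qHermite q c (Suc n)"
    let ?g = "- smult (c * q ^ n * qint q (Suc n)) (qHermite q c n)"
    have H: "degree (qHermite q c (Suc n)) = Suc n" "lead_coeff (qHermite q c (Suc n)) = 1"
      using 3 by blast+
    have f: "degree ?f = Suc (Suc n)"
      using H by (subst degree_mult_eq) auto
    have g: "degree ?g \<le> n"
      using 3 by (simp add: degree_smult_le)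
    have eq: "qHermite q c (Suc (Suc n)) = ?g + ?f" by simp
    have lf: "lead_coeff ?f = 1" unfolding lead_coeff_mult H(2) by simp
    have less: "degree ?g < degree ?f" using f g by linarith
    show ?case
      unfolding eq by (intro conjI trans[OF degree_add_eq_right[OF less] f] trans[OF lead_coeff_add_le[OF less] lf])
  qed simp_all
  then show "degree (qHermite q c n) = n" "lead_coeff (qHermite q c n) = 1" by auto
qed

text \<open>Writing X = U + D with U and D the raising and lowering operators and K H_n = q^n H_n, this is
  the term U^s K^(2m) D^l of the normally ordered expansion of a power of X, applied to H_j.\<close>

definition normal_term :: "real \<Rightarrow> real \<Rightarrow> nat \<Rightarrow> nat \<times> nat \<times> nat \<Rightarrow> real poly" where
  "normal_term q c j = (\<lambda>(m, s, l).
     smult (c ^ (m + l) * q ^ (2 * m * (j - l)) * (\<Prod>i<l. q ^ (j - 1 - i) * qint q (j - i)) /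
            (qdfac_even q m * qfac q s * qfac q l))
       (qHermite q c (j - l + s)))"

definition triples :: "nat \<Rightarrow> (nat \<times> nat \<times> nat) set" where
  "triples n = {(m, s, l). 2 * m + s + l = n}"

lemma finite_triples [simp]: "finite (triples n)"
proof (rule finite_subset)
  show "triples n \<subseteq> {..n} \<times> {..n} \<times> {..n}" by (auto simp: triples_def)
qed simp

text \<open>D^l annihilates H_j: the factor i = j contains [0].\<close>

lemma normal_term_eq_0: "j < l \<Longrightarrow> normal_term q c j (m, s, l) = 0"
proof -
  assume "j < l"
  then have "(\<Prod>i<l. q ^ (j - 1 - i) * qint q (j - i)) = 0"
    by (intro prod_zero bexI[of _ j]) auto
  then show ?thesis by (simp add: normal_term_def)
qed

text \<open>The first summand is U; the other two arise from moving D to the right by D U^s = q^s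
  U^s D + c q^(s-1) [s] U^(s-1) K^2 and D K^(2m) = q^(2m) K^(2m) D. On H_i with i = j - l this is
  [i+s] = [i] + q^i [s]. The brackets compensate the denominators of the neighbouring terms.\<close>

lemma X_mult_normal_term:
  assumes "q > 0"
  shows "[:0, 1:] * normal_term q c j (m, s, l) =
    smult (qint q (Suc s)) (normal_term q c j (m, Suc s, l))
    + smult (q ^ (s + 2 * m) * qint q (Suc l)) (normal_term q c j (m, s, Suc l))
    + (case s of 0 \<Rightarrow> 0 | Suc t \<Rightarrow> smult (q ^ t * qint q (2 * Suc m)) (normal_term q c j (Suc m, t, l)))"
proof (cases "l \<le> j")
  case False
  then show ?thesis by (cases s) (simp_all add: normal_term_eq_0)
next
  case True
  define i where "i = j - l"
  define v where "v = (\<Prod>i<l. q ^ (j - 1 - i) * qint q (j - i))"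
  define A where "A = c ^ (m + l) * q ^ (2 * m * i) * v / (qdfac_even q m * qfac q s * qfac q l)"
  let ?H = "qHermite q c"
  have nz: "qint q (Suc k) \<noteq> 0" "qfac q k \<noteq> 0" "qdfac_even q k \<noteq> 0" for k
    using qint_pos[OF assms, of "Suc k"] qfac_pos[OF assms, of k] qdfac_even_pos[OF assms, of k] by simp_all
  have nz2: "qint q (2 * Suc m) \<noteq> 0"
    using qint_pos[OF assms, of "2 * Suc m"] by simp
  have T0: "normal_term q c j (m, s, l) = smult A (?H (i + s))"
    by (simp add: normal_term_def A_def v_def i_def)
  have T1: "smult (qint q (Suc s)) (normal_term q c j (m, Suc s, l)) = smult A (?H (Suc (i + s)))"
    using nz by (simp add: normal_term_def A_def v_def i_def mult_ac)
  have T2: "smult (q ^ (s + 2 * m) * qint q (Suc l)) (normal_term q c j (m, s, Suc l))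
    = smult (A * c * q ^ (i + s - 1) * qint q i) (?H (i + s - 1))"
  proof (cases i)
    case 0
    then have "l = j" using True i_def by simp
    then show ?thesis by (simp add: 0 normal_term_eq_0)
  next
    case (Suc h)
    have h: "j - Suc l = h" "j - 1 - l = h" "j - l = Suc h" using Suc i_def by auto
    have "normal_term q c j (m, s, Suc l) = smult (c ^ (m + Suc l) * q ^ (2 * m * h) * (v * (q ^ h * qint q i)) /
            (qdfac_even q m * qfac q s * (qfac q l * qint q (Suc l)))) (?H (h + s))"
      unfolding normal_term_def by (simp add: h v_def Suc)
    moreover have "q ^ (s + 2 * m) * qint q (Suc l) * (c ^ (m + Suc l) * q ^ (2 * m * h) * (v * (q ^ h * qint q i)) /
            (qdfac_even q m * qfac q s * (qfac q l * qint q (Suc l)))) = A * c * q ^ (h + s) * qint q i"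
      unfolding A_def Suc using nz by (simp add: power_add field_simps del: qfac_Suc)
    ultimately show ?thesis by (simp add: Suc)
  qed
  have T3: "(case s of 0 \<Rightarrow> 0 | Suc t \<Rightarrow> smult (q ^ t * qint q (2 * Suc m)) (normal_term q c j (Suc m, t, l)))
    = smult (A * c * q ^ (i + s - 1) * (q ^ i * qint q s)) (?H (i + s - 1))"
  proof (cases s)
    case (Suc t)
    have "2 * Suc m * i = 2 * m * i + i + i" by simp
    then have e: "q ^ (2 * Suc m * i) = q ^ (2 * m * i) * q ^ i * q ^ i"
      by (simp only: power_add)
    have "normal_term q c j (Suc m, t, l) = smult (c * c ^ (m + l) * (q ^ (2 * m * i) * q ^ i * q ^ i) * v /
            (qdfac_even q m * qint q (2 * Suc m) * qfac q t * qfac q l)) (?H (i + t))"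
      unfolding normal_term_def prod.case e i_def[symmetric] v_def[symmetric]
      by (simp add: power_add mult_ac)
    moreover have "q ^ t * qint q (2 * Suc m) * (c * c ^ (m + l) * (q ^ (2 * m * i) * q ^ i * q ^ i) * v /
            (qdfac_even q m * qint q (2 * Suc m) * qfac q t * qfac q l))
       = A * c * q ^ (i + t) * (q ^ i * qint q s)"
      unfolding A_def Suc qfac_Suc using nz nz2 by (simp add: power_add field_simps)
    ultimately show ?thesis by (simp add: Suc)
  qed simp
  have "[:0, 1:] * normal_term q c j (m, s, l) = smult A ([:0, 1:] * ?H (i + s))"
    unfolding T0 by (simp only: mult_smult_right)
  also have "\<dots> = smult A (?H (Suc (i + s)))
     + smult (A * c * q ^ (i + s - 1) * qint q i) (?H (i + s - 1))
     + smult (A * c * q ^ (i + s - 1) * (q ^ i * qint q s)) (?H (i + s - 1))"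
    unfolding X_mult_qHermite qint_add[of q i s]
    by (simp add: smult_add_right algebra_simps flip: smult_add_left)
  finally show ?thesis unfolding T1 T2 T3 .
qed

text \<open>With the denominators of \<open>normal_term\<close>, the three contributions to a triple
  of \<open>triples (Suc n)\<close> add up to [s] + q^s [2m] + q^(s+2m) [l] = [n+1], the same for
  all triples; hence the common prefactor [n]!.\<close>

lemma X_power_mult_qHermite:
  assumes "q > 0"
  shows "[:0, 1:] ^ n * qHermite q c j = smult (qfac q n) (\<Sum>x\<in>triples n. normal_term q c j x)"
proof (induction n)
  case 0
  have "triples 0 = {(0, 0, 0)}" by (auto simp: triples_def)
  then show ?case by (simp add: normal_term_def)
next
  case (Suc n)
  let ?T = "normal_term q c j"
  have 1: "(\<Sum>(m, s, l)\<in>triples n. smult (qint q (Suc s)) (?T (m, Suc s, l)))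
    = (\<Sum>(m, s, l)\<in>triples (Suc n). smult (qint q s) (?T (m, s, l)))"
    by (rule sum.reindex_bij_witness_not_neutral[of "{}" "{x\<in>triples (Suc n). fst (snd x) = 0}" _
        "\<lambda>(m, s, l). (m, s - 1, l)" "\<lambda>(m, s, l). (m, Suc s, l)"])
      (simp_all, auto simp: triples_def)
  have 2: "(\<Sum>(m, s, l)\<in>triples n. smult (q ^ (s + 2 * m) * qint q (Suc l)) (?T (m, s, Suc l)))
    = (\<Sum>(m, s, l)\<in>triples (Suc n). smult (q ^ (s + 2 * m) * qint q l) (?T (m, s, l)))"
    by (rule sum.reindex_bij_witness_not_neutral[of "{}" "{x\<in>triples (Suc n). snd (snd x) = 0}" _
        "\<lambda>(m, s, l). (m, s, l - 1)" "\<lambda>(m, s, l). (m, s, Suc l)"])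
      (simp_all, auto simp: triples_def)
  \<comment> \<open>Indices with s = 0 have no contraction to perform; they are sent to
    \<open>(0, 0, 0)\<close>, where the target summand vanishes because of [0] = 0.\<close>
  have 3: "(\<Sum>(m, s, l)\<in>triples n. case s of 0 \<Rightarrow> 0 | Suc t \<Rightarrow>
      smult (q ^ t * qint q (2 * Suc m)) (?T (Suc m, t, l)))
    = (\<Sum>(m, s, l)\<in>triples (Suc n). smult (q ^ s * qint q (2 * m)) (?T (m, s, l)))"
    by (rule sum.reindex_bij_witness_not_neutral[of "{x\<in>triples n. fst (snd x) = 0}" "{x\<in>triples (Suc n). fst x = 0}" _
        "\<lambda>(m, s, l). (m - 1, Suc s, l)" "\<lambda>(m, s, l). if s = 0 then (0, 0, 0) else (Suc m, s - 1, l)"])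
      (simp_all, auto simp: triples_def split: nat.splits)
  have "(\<Sum>x\<in>triples n. [:0, 1:] * ?T x)
    = (\<Sum>(m, s, l)\<in>triples n. smult (qint q (Suc s)) (?T (m, Suc s, l))
      + smult (q ^ (s + 2 * m) * qint q (Suc l)) (?T (m, s, Suc l))
      + (case s of 0 \<Rightarrow> 0 | Suc t \<Rightarrow> smult (q ^ t * qint q (2 * Suc m)) (?T (Suc m, t, l))))"
    by (intro sum.cong refl, clarify, rule X_mult_normal_term[OF assms])
  also have "\<dots> = (\<Sum>(m, s, l)\<in>triples (Suc n). smult (qint q s) (?T (m, s, l))
      + smult (q ^ (s + 2 * m) * qint q l) (?T (m, s, l)) + smult (q ^ s * qint q (2 * m)) (?T (m, s, l)))"
    using 1 2 3 by (simp add: sum.distrib case_prod_beta)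
  also have "\<dots> = (\<Sum>x\<in>triples (Suc n). smult (qint q (Suc n)) (?T x))"
  proof (intro sum.cong refl, clarify)
    fix m s l assume "(m, s, l) \<in> triples (Suc n)"
    then have "Suc n = s + (2 * m + l)" by (simp add: triples_def)
    then have "qint q (Suc n) = qint q s + q ^ (s + 2 * m) * qint q l + q ^ s * qint q (2 * m)"
      by (simp only: qint_add) (simp add: power_add algebra_simps)
    then show "smult (qint q s) (?T (m, s, l)) + smult (q ^ (s + 2 * m) * qint q l) (?T (m, s, l))
      + smult (q ^ s * qint q (2 * m)) (?T (m, s, l)) = smult (qint q (Suc n)) (?T (m, s, l))"
      by (simp add: smult_add_left)
  qed
  also have "\<dots> = smult (qint q (Suc n)) (\<Sum>x\<in>triples (Suc n). ?T x)"
    using sum_distrib_left[of "[:qint q (Suc n):]" ?T "triples (Suc n)"] by simp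
  finally have *: "(\<Sum>x\<in>triples n. [:0, 1:] * ?T x) = smult (qint q (Suc n)) (\<Sum>x\<in>triples (Suc n). ?T x)" .
  have "[:0, 1:] ^ Suc n * qHermite q c j = [:0, 1:] * ([:0, 1:] ^ n * qHermite q c j)"
    by (simp only: power_Suc mult.assoc)
  also have "\<dots> = smult (qfac q n) (\<Sum>x\<in>triples n. [:0, 1:] * ?T x)"
    unfolding Suc.IH mult_smult_right sum_distrib_left ..
  finally show ?case unfolding * by (simp add: mult.commute)
qed

section \<open>Orthogonality from the moment recurrence\<close>

locale Hermite_functional =
  fixes q c :: real and L :: "real poly \<Rightarrow> real"
  assumes q_pos: "q > 0"
    and add: "L (f + g) = L f + L g"
    and scale: "L (smult a f) = a * L f"
    and one: "L 1 = 1"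
    and X: "L [:0, 1:] = 0"
    and X_power: "L ([:0, 1:] ^ Suc (Suc n)) = c * qint q (Suc n) * L ([:0, 1:] ^ n)"
begin

lemma zero [simp]: "L 0 = 0"
  using scale[of 0 0] by simp

lemma const: "L [:a:] = a"
  using scale[of a 1] one by simp

lemma sum: "L (sum f A) = (\<Sum>x\<in>A. L (f x))"
  by (induction A rule: infinite_finite_induct) (simp_all add: add)

lemma diff: "L (f - g) = L f - L g"
  using add[of f "smult (- 1) g"] scale[of "- 1" g] by simp

lemma moment_even: "L ([:0, 1:] ^ (2 * p)) = c ^ p * qdfac_odd q p"
proof (induction p)
  case (Suc p)
  have eq: "2 * Suc p = Suc (Suc (2 * p))" by simp
  show ?case unfolding eq X_power Suc.IH by simp
qed (simp add: one)

lemma moment_odd: "L ([:0, 1:] ^ Suc (2 * p)) = 0"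
proof (induction p)
  case (Suc p)
  have eq: "Suc (2 * Suc p) = Suc (Suc (Suc (2 * p)))" by simp
  show ?case unfolding eq X_power Suc.IH by simp
qed (simp add: X)

text \<open>The squared norm of H_n, as the product of the recurrence coefficients c q^i [i+1] over
  i < n.\<close>

definition "h n = c ^ n * q ^ (n * (n - 1) div 2) * qfac q n"

lemma h_Suc: "h (Suc n) = c * q ^ n * qint q (Suc n) * h n"
  unfolding h_def diff_Suc_1 triangle_Suc by (simp add: power_add)

text \<open>Normal ordering of X^N applied to H_0 leaves only l = 0. Under \<open>L\<close>,
  induction kills every H_s with 0 < s < N, and the fully contracted term s = 0, present for even N,
  is already the whole moment L(X^N); so nothing is left for L(H_N).\<close>

lemma qHermite_Suc_eq_0: "L (qHermite q c (Suc n)) = 0"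
proof (induction n rule: less_induct)
  case (less n)
  let ?N = "Suc n"
  let ?T = "normal_term q c 0"
  have T: "?T (m, s, l) = (if l = 0 then smult (c ^ m / (qdfac_even q m * qfac q s)) (qHermite q c s) else 0)" for m s l
    using normal_term_eq_0[of 0 l] by (auto simp: normal_term_def)
  have "L ([:0, 1:] ^ ?N) = qfac q ?N * (\<Sum>x\<in>triples ?N. L (?T x))"
    using X_power_mult_qHermite[OF q_pos, of ?N c 0] by (simp only: qHermite.simps mult_1_right scale sum)
  also have "(\<Sum>x\<in>triples ?N. L (?T x)) = (\<Sum>x\<in>{(0, ?N, 0)} \<union> (if odd n then {(?N div 2, 0, 0)} else {}). L (?T x))"
  proof (rule sum.mono_neutral_right)
    show "\<forall>x\<in>triples ?N - ({(0, ?N, 0)} \<union> (if odd n then {(?N div 2, 0, 0)} else {})). L (?T x) = 0"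
    proof
      fix x assume x': "x \<in> triples ?N - ({(0, ?N, 0)} \<union> (if odd n then {(?N div 2, 0, 0)} else {}))"
      obtain m s l where [simp]: "x = (m, s, l)" by (cases x)
      have x: "(m, s, l) \<in> triples ?N" "(m, s, l) \<notin> {(0, ?N, 0)} \<union> (if odd n then {(?N div 2, 0, 0)} else {})"
        using x' by simp_all
      show "L (?T x) = 0"
      proof (cases "l = 0")
        case True
        have "s \<noteq> 0"
        proof
          assume "s = 0"
          with True x(1) have n: "2 * m = ?N" by (simp add: triples_def)
          then have "odd n" by presburger
          moreover have "m = ?N div 2" using n by simp
          ultimately show False using x(2) \<open>s = 0\<close> True by simp
        qed
        then obtain t where "s = Suc t" by (cases s) auto
        moreover from this have "t < n" using x True by (auto simp: triples_def)
        ultimately show ?thesis using less.IH[of t] True by (simp add: T scale)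
      qed (simp add: T)
    qed
  qed (rule finite_triples, auto simp: triples_def)
  also have "\<dots> = L (qHermite q c ?N) / qfac q ?N + (if odd n then L (?T (?N div 2, 0, 0)) else 0)"
    by (auto simp: T scale)
  finally have main: "L ([:0, 1:] ^ ?N)
    = L (qHermite q c ?N) + qfac q ?N * (if odd n then L (?T (?N div 2, 0, 0)) else 0)"
    using qfac_pos[OF q_pos, of ?N]
    by (simp only: distrib_left times_divide_eq_right nonzero_mult_div_cancel_left less_irrefl not_False_eq_True)
  show ?case
  proof (cases "odd n")
    case True
    then obtain m where m: "?N = 2 * m" by (metis even_Suc evenE)
    have "L ([:0, 1:] ^ ?N) = c ^ m * qdfac_odd q m" unfolding m by (rule moment_even)
    \<comment> \<open>Since [2m]! / [2m]!! = [2m-1]!!, the contracted term reproduces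
      \<open>moment_even\<close>.\<close>
    moreover have "qfac q ?N * L (?T (?N div 2, 0, 0)) = c ^ m * qdfac_odd q m"
      unfolding m qfac_double using qdfac_even_pos[OF q_pos, of m] by (simp add: T const)
    ultimately show ?thesis using main True by simp
  next
    case False
    then obtain m where "n = 2 * m" by (metis evenE)
    then show ?thesis using main False moment_odd[of m] by simp
  qed
qed

text \<open>Moving one factor X onto H_n lowers the exponent by 1 and the index by at most 1, so the
  gap stays positive down to exponent 0.\<close>

lemma mult_qHermite_less: "m < n \<Longrightarrow> L ([:0, 1:] ^ m * qHermite q c n) = 0"
proof (induction m arbitrary: n)
  case 0
  then obtain k where "n = Suc k" by (cases n) auto
  then show ?case using qHermite_Suc_eq_0 by simp
next
  case (Suc m)
  have "[:0, 1:] ^ Suc m * qHermite q c n = [:0, 1:] ^ m * ([:0, 1:] * qHermite q c n)"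
    by (simp only: power_Suc2 mult.assoc)
  also have "\<dots> = [:0, 1:] ^ m * qHermite q c (Suc n)
    + smult (c * q ^ (n - 1) * qint q n) ([:0, 1:] ^ m * qHermite q c (n - 1))"
    unfolding X_mult_qHermite distrib_left mult_smult_right ..
  finally show ?case using Suc.IH[of "Suc n"] Suc.IH[of "n - 1"] Suc.prems by (simp add: add scale)
qed

lemma mult_qHermite_same: "L ([:0, 1:] ^ n * qHermite q c n) = h n"
proof (induction n)
  case 0
  then show ?case by (simp add: one h_def)
next
  case (Suc n)
  have "[:0, 1:] ^ Suc n * qHermite q c (Suc n) = [:0, 1:] ^ n * ([:0, 1:] * qHermite q c (Suc n))"
    by (simp only: power_Suc2 mult.assoc)
  also have "\<dots> = [:0, 1:] ^ n * qHermite q c (Suc (Suc n))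
    + smult (c * q ^ n * qint q (Suc n)) ([:0, 1:] ^ n * qHermite q c n)"
    unfolding X_mult_qHermite distrib_left mult_smult_right by simp
  finally show ?case using Suc.IH mult_qHermite_less[of n "Suc (Suc n)"]
    by (simp add: add scale h_Suc del: qHermite.simps)
qed

lemma mult_qHermite:
  assumes "degree f \<le> n"
  shows "L (f * qHermite q c n) = coeff f n * h n"
proof -
  have "f = (\<Sum>i\<le>n. smult (coeff f i) ([:0, 1:] ^ i))"
    using poly_as_sum_of_monoms'[OF assms] by (simp add: monom_altdef)
  then have "L (f * qHermite q c n) = L (\<Sum>i\<le>n. smult (coeff f i) ([:0, 1:] ^ i * qHermite q c n))"
    by (metis (no_types, lifting) mult_smult_left sum.cong sum_distrib_right)
  also have "\<dots> = (\<Sum>i\<le>n. coeff f i * L ([:0, 1:] ^ i * qHermite q c n))"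
    by (simp only: sum scale)
  also have "\<dots> = (\<Sum>i\<in>{n}. coeff f i * L ([:0, 1:] ^ i * qHermite q c n))"
    by (rule sum.mono_neutral_right) (auto simp: mult_qHermite_less)
  finally show ?thesis by (simp add: mult_qHermite_same)
qed

lemma qHermite_orthogonal: "L (qHermite q c m * qHermite q c n) = (if m = n then h n else 0)"
proof (cases m n rule: linorder_cases)
  case greater
  then show ?thesis using mult_qHermite[of "qHermite q c n" m]
    by (simp add: degree_qHermite coeff_eq_0 mult.commute)
qed (use mult_qHermite[of "qHermite q c m" n] lead_coeff_qHermite[of q c n] in
    \<open>simp_all add: degree_qHermite coeff_eq_0\<close>)

section \<open>Diagonal matrix elements of even powers\<close>

lemma prod_lowering:
  "l \<le> j \<Longrightarrow> (\<Prod>i<l. q ^ (j - 1 - i) * qint q (j - i)) = q ^ (l * (j - l) + l * (l - 1) div 2) * gbin q j l * qfac q l"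
proof (induction l)
  case (Suc l)
  have e: "l * (j - l) + l * (l - 1) div 2 + (j - 1 - l) = Suc l * (j - Suc l) + Suc l * (Suc l - 1) div 2"
  proof -
    obtain d where "j = Suc l + d" using Suc.prems le_Suc_ex by blast
    then show ?thesis unfolding diff_Suc_1 triangle_Suc by (simp add: algebra_simps)
  qed
  have "l \<le> j" using Suc.prems by simp
  have "(\<Prod>i<Suc l. q ^ (j - 1 - i) * qint q (j - i))
    = q ^ (l * (j - l) + l * (l - 1) div 2 + (j - 1 - l)) * (gbin q j l * qint q (j - l)) * qfac q l"
    unfolding prod.lessThan_Suc Suc.IH[OF \<open>l \<le> j\<close>] power_add[of _ _ "j - 1 - l"] by (simp only: mult_ac)
  then show ?case
    unfolding e gbin_Suc_right[OF q_pos, symmetric] by (simp add: mult_ac)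
qed simp

text \<open>Orthogonality keeps the normally ordered terms that return to H_j, those with s = l and
  hence m = p - l; the sum over triples collapses to the single index l.\<close>

lemma moment_qHermite:
  "L ([:0, 1:] ^ (2 * p) * (qHermite q c j)\<^sup>2) = c ^ p * h j * positive_sum q p j"
proof -
  let ?H = "qHermite q c"
  let ?T = "normal_term q c j"
  define w where "w l = q ^ ((j - l) * (2 * p - l) + l * (l - 1) div 2) * gbin q j l
      / (qdfac_even q (p - l) * qfac q l)" for l
  have T: "L (?T (m, s, l) * ?H j) = (if s = l then c ^ p * h j * w l else 0)"
    if mem: "(m, s, l) \<in> triples (2 * p)" for m s l
  proof (cases "l \<le> j")
    case True
    have "L (?T (m, s, l) * ?H j) = c ^ (m + l) * q ^ (2 * m * (j - l)) *
        (q ^ (l * (j - l) + l * (l - 1) div 2) * gbin q j l * qfac q l) /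
        (qdfac_even q m * qfac q s * qfac q l) * L (?H (j - l + s) * ?H j)"
      unfolding normal_term_def prod.case prod_lowering[OF True] mult_smult_left scale ..
    moreover have "j - l + s = j \<longleftrightarrow> s = l" using True by auto
    \<comment> \<open>The exponent 2m(j-l) stems from K^(2m), the other one from D^l; they combine
      because 2m + l = 2p - l.\<close>
    moreover have "m + l = p" "p - l = m" "q ^ (2 * m * (j - l)) * q ^ (l * (j - l) + l * (l - 1) div 2)
        = q ^ ((j - l) * (2 * p - l) + l * (l - 1) div 2)" if "s = l"
    proof -
      show p: "m + l = p" using mem that by (simp add: triples_def)
      then show "p - l = m" by auto
      have "2 * p - l = 2 * m + l" using p by auto
      then show "q ^ (2 * m * (j - l)) * q ^ (l * (j - l) + l * (l - 1) div 2)
        = q ^ ((j - l) * (2 * p - l) + l * (l - 1) div 2)"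
        by (simp add: algebra_simps flip: power_add)
    qed
    ultimately show ?thesis
      using qfac_pos[OF q_pos, of l] by (auto simp: qHermite_orthogonal w_def)
  qed (simp add: normal_term_eq_0 w_def gbin_eq_0)
  have "[:0, 1:] ^ (2 * p) * (?H j)\<^sup>2 = smult (qfac q (2 * p)) (\<Sum>x\<in>triples (2 * p). ?T x * ?H j)"
    unfolding power2_eq_square mult.assoc[symmetric] X_power_mult_qHermite[OF q_pos]
    by (simp add: sum_distrib_right)
  then have "L ([:0, 1:] ^ (2 * p) * (?H j)\<^sup>2) = qfac q (2 * p) * (\<Sum>x\<in>triples (2 * p). L (?T x * ?H j))"
    by (simp add: scale sum)
  also have "(\<Sum>x\<in>triples (2 * p). L (?T x * ?H j))
    = (\<Sum>x\<in>(\<lambda>l. (p - l, l, l)) ` {..p}. L (?T x * ?H j))"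
  proof (rule sum.mono_neutral_right)
    show "\<forall>x\<in>triples (2 * p) - (\<lambda>l. (p - l, l, l)) ` {..p}. L (?T x * ?H j) = 0"
    proof
      fix x assume x: "x \<in> triples (2 * p) - (\<lambda>l. (p - l, l, l)) ` {..p}"
      obtain m s l where xd: "x = (m, s, l)" by (cases x)
      have mem: "(m, s, l) \<in> triples (2 * p)" using x xd by simp
      have "s \<noteq> l"
      proof
        assume "s = l"
        then have "m + l = p" using mem by (simp add: triples_def)
        then have "x = (p - l, l, l)" "l \<le> p" using xd \<open>s = l\<close> by auto
        then show False using x by blast
      qed
      then show "L (?T x * ?H j) = 0" using T[OF mem] xd by simp
    qed
  qed (rule finite_triples, auto simp: triples_def)
  also have "\<dots> = (\<Sum>l\<le>p. L (?T (p - l, l, l) * ?H j))"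
    by (simp add: sum.reindex inj_on_def)
  also have "\<dots> = (\<Sum>l\<le>p. c ^ p * h j * w l)"
    by (intro sum.cong refl) (simp add: T triples_def)
  finally show ?thesis
    by (simp add: positive_sum_def w_def sum_distrib_left sum_distrib_right mult_ac)
qed

end

section \<open>The Jackson functional\<close>

lemma qpoch_LIMSEQ:
  assumes "0 < q" "q < 1" "\<bar>a\<bar> \<le> 1" "a \<noteq> 1"
  shows "qpoch q a \<longlonglongrightarrow> qpoch_inf q a" and "qpoch_inf q a \<noteq> 0"
proof -
  let ?f = "\<lambda>i. 1 - a * q ^ i"
  have "summable (\<lambda>i. norm (?f i - 1))"
    using assms by (simp add: abs_mult summable_mult summable_geometric)
  then have c: "convergent_prod ?f"
    by (intro abs_convergent_prod_imp_convergent_prod) (simp add: abs_convergent_prod_conv_summable)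
  have "?f i \<noteq> 0" for i
  proof (cases i)
    case (Suc k)
    have "\<bar>a * q ^ i\<bar> \<le> 1 * q ^ i" unfolding abs_mult using assms by (intro mult_mono) auto
    also have "\<dots> < 1" using assms Suc power_Suc_less_one[of q] by (simp del: power_Suc)
    finally show ?thesis by auto
  qed (use assms in simp)
  then show "qpoch_inf q a \<noteq> 0"
    unfolding qpoch_inf_def using c by (simp add: prodinf_nonzero)
  have "(\<lambda>n. \<Prod>i\<le>n. ?f i) \<longlonglongrightarrow> qpoch_inf q a"
    unfolding qpoch_inf_def by (rule convergent_prod_LIMSEQ[OF c])
  then have "(\<lambda>n. qpoch q a (Suc n)) \<longlonglongrightarrow> qpoch_inf q a"
    by (simp add: qpoch_def lessThan_Suc_atMost)
  then show "qpoch q a \<longlonglongrightarrow> qpoch_inf q a"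
    by (simp add: LIMSEQ_imp_Suc filterlim_sequentially_Suc)
qed

lemma qpoch_eq_qprod: "qpoch q a n = qprod q a n"
  by (simp add: qpoch_def qprod_def)

lemma qpoch_inf_shift:
  assumes "0 < q" "q < 1" "\<bar>a\<bar> \<le> 1" "a \<noteq> 1"
  shows "qpoch_inf q a = qprod q a k * qpoch_inf q (a * q ^ k)"
proof (cases k)
  case (Suc k')
  have "\<bar>a * q ^ k\<bar> \<le> 1 * q ^ k" unfolding abs_mult using assms by (intro mult_mono) auto
  also have "\<dots> < 1" using assms Suc power_Suc_less_one[of q] by (simp del: power_Suc)
  finally have a': "\<bar>a * q ^ k\<bar> \<le> 1" "a * q ^ k \<noteq> 1" by auto
  have "(\<lambda>n. qpoch q a (n + k)) \<longlonglongrightarrow> qpoch_inf q a"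
    using qpoch_LIMSEQ(1)[OF assms] by (rule LIMSEQ_ignore_initial_segment)
  moreover have "(\<lambda>n. qpoch q a (n + k)) = (\<lambda>n. qprod q a k * qpoch q (a * q ^ k) n)"
    unfolding qpoch_eq_qprod add.commute[of _ k] qprod_add ..
  ultimately show ?thesis
    using tendsto_mult_left[OF qpoch_LIMSEQ(1)[OF assms(1,2) a'], of "qprod q a k"] LIMSEQ_unique by metis
qed simp

section \<open>The weight on the lattice and its moments\<close>

locale q_unit_interval =
  fixes q :: real
  assumes q: "0 < q" "q < 1"
begin

lemma q_power_bounds: "0 < q ^ n" "q ^ n \<le> 1" "q ^ Suc n < 1"
  using q by (simp_all add: power_le_one power_Suc_less_one del: power_Suc)

definition "q2_prod k = qprod (q\<^sup>2) (q\<^sup>2) k"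

lemma q2_prod_Suc: "q2_prod (Suc k) = q2_prod k * (1 - q ^ (2 * Suc k))"
  by (simp only: q2_prod_def qprod_Suc power_mult power_Suc)

lemma q2_prod_pos: "q2_prod k > 0"
proof (induction k)
  case (Suc k)
  have "q ^ (2 * Suc k) < 1" using q_power_bounds(3)[of "Suc (2 * k)"] by simp
  then show ?case using Suc by (simp add: q2_prod_Suc)
qed (simp add: q2_prod_def)

lemma q2_prod_eq: "q2_prod k = qprod q q k * qprod q (- q) k"
  by (simp add: q2_prod_def qprod_mult_uminus)

text \<open>On the lattice the numerator consists of tails of (q;q)_inf and (-q;q)_inf. They cancel
  against the denominator down to finite products, which pair to (q^2;q^2)_k.\<close>

lemma dqH_weight_q_power:
  assumes "\<bar>x\<bar> = q ^ k"
  shows "dqH_weight q x = 1 / (qpoch_inf q (- 1) * q2_prod k)"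
proof -
  have nz: "qpoch_inf q q \<noteq> 0" "qpoch_inf q (- q) \<noteq> 0"
    using qpoch_LIMSEQ(2)[of q q] qpoch_LIMSEQ(2)[of q "- q"] q by simp_all
  have 1: "qpoch_inf q q = qprod q q k * qpoch_inf q (q * q ^ k)"
    using q by (intro qpoch_inf_shift) auto
  have 2: "qpoch_inf q (- q) = qprod q (- q) k * qpoch_inf q (- q * q ^ k)"
    using q by (intro qpoch_inf_shift) auto
  have "x = q ^ k \<or> x = - (q ^ k)" using assms by auto
  then have "qpoch_inf q (q * x) * qpoch_inf q (- (q * x)) = qpoch_inf q (q * q ^ k) * qpoch_inf q (- q * q ^ k)"
    by auto
  then show ?thesis
    using nz 1 2 by (auto simp: dqH_weight_def q2_prod_eq field_simps)
qed

text \<open>Up to normalization the n-th moment on the positive half of the lattice; the Jackson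
  factor q^k turns n into \<open>Suc n\<close>. By Euler the series equals 1 /
  (q^(n+1);q^2)_inf.\<close>

definition "jackson_moment n = (\<Sum>k. q ^ (k * Suc n) / q2_prod k)"

text \<open>The finite products decrease to the positive limit (q^2;q^2)_inf, so a geometric series
  dominates.\<close>

lemma summable_geometric_q2_prod: "0 \<le> b \<Longrightarrow> b < 1 \<Longrightarrow> summable (\<lambda>k. b ^ k / q2_prod k)"
proof (rule summable_comparison_test_ev)
  assume b: "0 \<le> b" "b < 1"
  let ?B = "qpoch_inf (q\<^sup>2) (q\<^sup>2)"
  have q2: "0 < q\<^sup>2" "q\<^sup>2 < 1" using q by (simp_all add: power_less_one_iff)
  have lim: "q2_prod \<longlonglongrightarrow> ?B" and "?B \<noteq> 0"
    using qpoch_LIMSEQ[of "q\<^sup>2" "q\<^sup>2"] q2 by (simp_all add: q2_prod_def[abs_def] qpoch_eq_qprod[abs_def])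
  have "decseq q2_prod"
  proof (rule decseq_SucI)
    fix k show "q2_prod (Suc k) \<le> q2_prod k"
      using q2_prod_pos[of k] q by (simp add: q2_prod_Suc mult_left_le)
  qed
  then have B: "?B \<le> q2_prod k" for k using lim by (rule decseq_ge)
  have "?B \<ge> 0" by (rule LIMSEQ_le_const[OF lim]) (use q2_prod_pos in \<open>auto intro: less_imp_le\<close>)
  with \<open>?B \<noteq> 0\<close> have "?B > 0" by simp
  then show "\<forall>\<^sub>F k in sequentially. norm (b ^ k / q2_prod k) \<le> b ^ k / ?B"
    using B b q2_prod_pos by (intro always_eventually allI) (simp add: abs_of_pos frac_le)
  show "summable (\<lambda>k. b ^ k / ?B)"
    using b by (intro summable_divide summable_geometric) simp
qed

lemma jackson_moment_summable: "summable (\<lambda>k. q ^ (k * Suc n) / q2_prod k)"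
proof -
  have "(q ^ Suc n) ^ k = q ^ (k * Suc n)" for k
    by (simp only: power_mult[symmetric] mult.commute)
  then show ?thesis
    using summable_geometric_q2_prod[of "q ^ Suc n"] q_power_bounds(3)[of n] q by (simp del: power_Suc mult_Suc_right)
qed

text \<open>The functional equation of the weight: in the difference of the two series the factor 1
  - q^(2k) removes the term k = 0 and cancels the last factor of \<open>q2_prod k\<close>, so the
  index shifts by one and q^(n+1) comes out.\<close>

lemma jackson_moment_Suc_Suc: "jackson_moment (Suc (Suc n)) = (1 - q ^ Suc n) * jackson_moment n"
proof -
  let ?f = "\<lambda>n k. q ^ (k * Suc n) / q2_prod k"
  have "jackson_moment n - jackson_moment (Suc (Suc n)) = (\<Sum>k. ?f n k - ?f (Suc (Suc n)) k)"
    unfolding jackson_moment_def by (rule suminf_diff[OF jackson_moment_summable jackson_moment_summable])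
  also have "\<dots> = (\<Sum>k. ?f n (Suc k) - ?f (Suc (Suc n)) (Suc k))"
    using suminf_split_head[OF summable_diff[OF jackson_moment_summable[of n] jackson_moment_summable[of "Suc (Suc n)"]]] by simp
  also have "\<dots> = (\<Sum>k. q ^ Suc n * ?f n k)"
  proof (intro suminf_cong)
    fix k
    have e: "Suc k * Suc n = Suc n + k * Suc n" "Suc k * Suc (Suc (Suc n)) = Suc n + k * Suc n + 2 * Suc k"
      by simp_all
    have nz: "1 - q ^ (2 * Suc k) \<noteq> 0" "q2_prod k \<noteq> 0"
      using q2_prod_pos[of k] q2_prod_pos[of "Suc k"] by (auto simp: q2_prod_Suc simp del: mult_Suc_right)
    have "?f n (Suc k) - ?f (Suc (Suc n)) (Suc k)
      = q ^ Suc n * q ^ (k * Suc n) * (1 - q ^ (2 * Suc k)) / (q2_prod k * (1 - q ^ (2 * Suc k)))"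
      unfolding e power_add q2_prod_Suc diff_divide_distrib[symmetric] by (simp only: right_diff_distrib mult_1_right)
    then show "?f n (Suc k) - ?f (Suc (Suc n)) (Suc k) = q ^ Suc n * ?f n k"
      using nz by simp
  qed
  also have "\<dots> = q ^ Suc n * jackson_moment n"
    unfolding jackson_moment_def by (rule suminf_mult[OF jackson_moment_summable])
  finally show ?thesis by (simp add: algebra_simps)
qed

text \<open>Only the leading term 1 survives: the others carry q^((k+1)(n+1)) \<le> q^n q^(k+1),
  which bounds the rest by q^n times the moment of order 0.\<close>

lemma jackson_moment_LIMSEQ: "jackson_moment \<longlonglongrightarrow> 1"
proof -
  have bound: "\<bar>jackson_moment n - 1\<bar> \<le> q ^ n * jackson_moment 0" for n
  proof -
    have s: "summable (\<lambda>k. q ^ (Suc k * Suc m) / q2_prod (Suc k))" for m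
      using jackson_moment_summable[of m] by (subst summable_Suc_iff)
    define R where "R n = (\<Sum>k. q ^ (Suc k * Suc n) / q2_prod (Suc k))" for n
    have R: "jackson_moment m - 1 = R m" for m
      unfolding jackson_moment_def R_def using suminf_split_head[OF jackson_moment_summable[of m]] by (simp add: q2_prod_def)
    have "R n \<ge> 0"
      unfolding R_def using q q2_prod_pos by (intro suminf_nonneg s) (simp add: less_imp_le)
    have "R n \<le> (\<Sum>k. q ^ n * (q ^ (Suc k * Suc 0) / q2_prod (Suc k)))"
      unfolding R_def
    proof (intro suminf_le s summable_mult)
      fix k
      have "q ^ (Suc k * Suc n) \<le> q ^ (n + Suc k * Suc 0)"
        using q by (intro power_decreasing) simp_all
      then show "q ^ (Suc k * Suc n) / q2_prod (Suc k) \<le> q ^ n * (q ^ (Suc k * Suc 0) / q2_prod (Suc k))"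
        unfolding power_add times_divide_eq_right using q2_prod_pos by (intro divide_right_mono) (auto intro: less_imp_le)
    qed
    also have "\<dots> = q ^ n * R 0"
      unfolding R_def by (rule suminf_mult[OF s])
    also have "\<dots> \<le> q ^ n * jackson_moment 0"
    proof -
      have "R 0 \<le> jackson_moment 0" using R[of 0] by linarith
      then show ?thesis using q_power_bounds(1)[of n] by (intro mult_left_mono) linarith+
    qed
    finally show ?thesis unfolding R using \<open>R n \<ge> 0\<close> by (simp only: abs_of_nonneg)
  qed
  have "(\<lambda>n. q ^ n * jackson_moment 0) \<longlonglongrightarrow> 0 * jackson_moment 0"
    using q by (intro tendsto_mult LIMSEQ_power_zero tendsto_const) simp
  then have "(\<lambda>n. q ^ n * jackson_moment 0) \<longlonglongrightarrow> 0" by simp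
  moreover have "\<forall>\<^sub>F n in sequentially. norm (jackson_moment n - 1) \<le> q ^ n * jackson_moment 0"
    using bound by (intro always_eventually allI) (simp only: real_norm_def)
  ultimately have "(\<lambda>n. jackson_moment n - 1) \<longlonglongrightarrow> 0"
    by (rule Lim_null_comparison[rotated])
  then show ?thesis by (rule LIM_zero_cancel)
qed

lemma qprod_double: "qprod q q (2 * n) = qprod (q\<^sup>2) q n * q2_prod n"
proof (induction n)
  case (Suc n)
  have "qprod q q (2 * Suc n) = qprod q q (2 * n) * ((1 - q * q ^ (2 * n)) * (1 - q ^ (2 * Suc n)))"
    by simp
  then show ?case unfolding Suc.IH q2_prod_Suc by (simp add: power_mult)
qed (simp add: q2_prod_def)

text \<open>By the recurrence the moment of order 2 n is the one of order 0 times (q; q^2)_n, and it tends to 1.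
  The value at 0 then follows from Euler's identity (q; q^2) (-q; q) = 1 for the infinite products.\<close>

lemma jackson_moment_0: "jackson_moment 0 = qpoch_inf q (- q)"
proof -
  have jackson_moment: "jackson_moment (2 * n) = qprod (q\<^sup>2) q n * jackson_moment 0" for n
  proof (induction n)
    case (Suc n)
    have "2 * Suc n = Suc (Suc (2 * n))" by simp
    then show ?case unfolding jackson_moment_Suc_Suc using Suc.IH jackson_moment_Suc_Suc[of "2 * n"] by (simp add: power_mult)
  qed simp
  have lim: "qprod q q \<longlonglongrightarrow> qpoch_inf q q" "qprod q (- q) \<longlonglongrightarrow> qpoch_inf q (- q)" "qpoch_inf q q \<noteq> 0"
    using qpoch_LIMSEQ[of q q] qpoch_LIMSEQ[of q "- q"] q by (simp_all add: qpoch_eq_qprod[abs_def])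
  have nz: "qprod q q n \<noteq> 0" for n
    using q2_prod_pos[of n] by (auto simp: q2_prod_eq)
  \<comment> \<open>Euler's identity in finite form, (q;q^2)_n (-q;q)_n = (q;q)_(2n) / (q;q)_n; the
    quotient tends to 1.\<close>
  have "qprod q (- q) n * jackson_moment (2 * n) = qprod q q (2 * n) / qprod q q n * jackson_moment 0" for n
    using nz[of n] by (simp add: jackson_moment qprod_double q2_prod_eq)
  moreover have "(\<lambda>n. qprod q q (2 * n) / qprod q q n * jackson_moment 0) \<longlonglongrightarrow> qpoch_inf q q / qpoch_inf q q * jackson_moment 0"
    using lim LIMSEQ_subseq_LIMSEQ[OF lim(1), of "\<lambda>n. 2 * n"]
    by (intro tendsto_intros) (auto simp: strict_mono_def o_def)
  moreover have "(\<lambda>n. qprod q (- q) n * jackson_moment (2 * n)) \<longlonglongrightarrow> qpoch_inf q (- q) * 1"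
    using lim LIMSEQ_subseq_LIMSEQ[OF jackson_moment_LIMSEQ, of "\<lambda>n. 2 * n"]
    by (intro tendsto_mult) (auto simp: strict_mono_def o_def)
  ultimately show ?thesis
    using lim(3) LIMSEQ_unique by fastforce
qed

text \<open>The Jackson integral against the weight, divided by 1 - q. The denominator is the
  constant (-1;q)_inf = 2 (-q;q)_inf left over from the weight, and the total mass is 1.\<close>

definition "jackson_functional f =
  (\<Sum>k. q ^ k / q2_prod k * (poly f (q ^ k) + poly f (- (q ^ k)))) / (2 * qpoch_inf q (- q))"

lemma poly_bounded_unit: "\<exists>B. \<forall>x. \<bar>x\<bar> \<le> 1 \<longrightarrow> \<bar>poly f x\<bar> \<le> B" for f :: "real poly"
proof -
  have "compact (poly f ` {-1..1})"
    by (intro compact_continuous_image continuous_intros compact_Icc)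
  then obtain B where "\<forall>y\<in>poly f ` {-1..1}. \<bar>y\<bar> \<le> B"
    using compact_imp_bounded bounded_iff by (metis real_norm_def)
  then show ?thesis by (intro exI[of _ B]) (auto simp: abs_le_iff)
qed

lemma jackson_summable: "summable (\<lambda>k. q ^ k / q2_prod k * (poly f (q ^ k) + poly f (- (q ^ k))))"
proof -
  obtain B where B: "\<And>x. \<bar>x\<bar> \<le> 1 \<Longrightarrow> \<bar>poly f x\<bar> \<le> B" using poly_bounded_unit by metis
  show ?thesis
  proof (rule summable_comparison_test_ev)
    show "summable (\<lambda>k. q ^ k / q2_prod k * (2 * B))"
      using summable_geometric_q2_prod[of q] q by (intro summable_mult2) simp
    show "\<forall>\<^sub>F k in sequentially. norm (q ^ k / q2_prod k * (poly f (q ^ k) + poly f (- (q ^ k)))) \<le> q ^ k / q2_prod k * (2 * B)"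
    proof (intro always_eventually allI)
      fix k
      have "\<bar>q ^ k\<bar> \<le> 1" "\<bar>- (q ^ k)\<bar> \<le> 1" using q_power_bounds[of k] by simp_all
      then have "\<bar>poly f (q ^ k) + poly f (- (q ^ k))\<bar> \<le> 2 * B"
        using B[of "q ^ k"] B[of "- (q ^ k)"] by linarith
      then show "norm (q ^ k / q2_prod k * (poly f (q ^ k) + poly f (- (q ^ k)))) \<le> q ^ k / q2_prod k * (2 * B)"
        using q_power_bounds(1)[of k] q2_prod_pos[of k] by (simp add: abs_mult divide_right_mono mult_left_mono)
    qed
  qed
qed

lemma jackson_functional_power:
  "jackson_functional ([:0, 1:] ^ n) = (if even n then jackson_moment n / qpoch_inf q (- q) else 0)"
proof (cases "even n")
  case True
  have "jackson_functional ([:0, 1:] ^ n) = (\<Sum>k. 2 * (q ^ (k * Suc n) / q2_prod k)) / (2 * qpoch_inf q (- q))"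
    using True by (simp add: jackson_functional_def poly_power power_add mult_ac flip: power_mult)
  also have "\<dots> = jackson_moment n / qpoch_inf q (- q)"
    by (subst suminf_mult[OF jackson_moment_summable]) (simp add: jackson_moment_def)
  finally show ?thesis using True by simp
qed (simp add: jackson_functional_def poly_power)

sublocale jackson: Hermite_functional q "1 - q" jackson_functional
proof
  show "jackson_functional (f + g) = jackson_functional f + jackson_functional g" for f g
    unfolding jackson_functional_def add_divide_distrib[symmetric] suminf_add[OF jackson_summable jackson_summable]
    by (simp add: algebra_simps)
  show "jackson_functional (smult a f) = a * jackson_functional f" for a f
    unfolding jackson_functional_def times_divide_eq_right suminf_mult[OF jackson_summable, symmetric]
    by (simp add: algebra_simps)
  show "jackson_functional 1 = 1"
    using jackson_functional_power[of 0] jackson_moment_0 qpoch_LIMSEQ(2)[of q "- q"] q by simp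
  show "jackson_functional [:0, 1:] = 0"
    using jackson_functional_power[of 1] by simp
  show "jackson_functional ([:0, 1:] ^ Suc (Suc n)) = (1 - q) * qint q (Suc n) * jackson_functional ([:0, 1:] ^ n)" for n
    unfolding jackson_functional_power one_minus_mult_qint jackson_moment_Suc_Suc by simp
qed (rule q)

lemma jackson_h: "jackson.h n = qpoch q q n * q ^ (n * (n - 1) div 2)"
proof -
  have "qpoch q q n = (1 - q) ^ n * qfac q n"
  proof (induction n)
    case (Suc n)
    have "qpoch q q (Suc n) = qpoch q q n * ((1 - q) * qint q (Suc n))"
      unfolding one_minus_mult_qint by (simp add: qpoch_def)
    then show ?case using Suc.IH by simp
  qed (simp add: qpoch_def)
  then show ?thesis by (simp add: jackson.h_def)
qed

text \<open>The prefactor 1 - q of the Jackson integral cancels against the one in the norm; the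
  power (1 - q)^p due to c = 1 - q is what the rescaling removes.\<close>

lemma dq_moment_hat_eq_positive_sum: "dq_moment_hat q p j = positive_sum q p j"
proof -
  let ?f = "[:0, 1:] ^ (2 * p) * (qHermite q (1 - q) j)\<^sup>2"
  let ?h = "qpoch q q j * q ^ (j * (j - 1) div 2)"
  have h: "jackson.h j = ?h" by (rule jackson_h)
  have "jackson.h j \<noteq> 0"
    using q qfac_pos[of q j] by (simp add: jackson.h_def)
  have "qpoch_inf q (- 1) = 2 * qpoch_inf q (- q)"
    using qpoch_inf_shift[of q "- 1" 1] q by simp
  then have w: "dqH_weight q x = 1 / (2 * qpoch_inf q (- q) * q2_prod k)" if "\<bar>x\<bar> = q ^ k" for x k
    using dqH_weight_q_power[OF that] by simp
  let ?g = "\<lambda>x. \<bar>x\<bar> ^ (2 * p) * (poly (dqHermite q j) x)\<^sup>2 * dqH_weight q x / ((1 - q) * ?h)"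
  have g: "?g x = poly ?f x / (2 * qpoch_inf q (- q) * q2_prod k * ((1 - q) * ?h))" if "\<bar>x\<bar> = q ^ k" for x k
    using that by (simp add: w[OF that] dqHermite_eq_qHermite poly_power power_even_abs flip: that)
  have "dq_moment q p j = (1 - q) * (\<Sum>k. q ^ k * (?g (q ^ k) + ?g (- (q ^ k))))"
    by (simp add: dq_moment_def jackson_integral_def mult.assoc)
  also have "(\<lambda>k. q ^ k * (?g (q ^ k) + ?g (- (q ^ k))))
    = (\<lambda>k. q ^ k / q2_prod k * (poly ?f (q ^ k) + poly ?f (- (q ^ k))) * inverse (2 * qpoch_inf q (- q) * ((1 - q) * ?h)))"
  proof
    fix k
    have a: "\<bar>q ^ k\<bar> = q ^ k" "\<bar>- (q ^ k)\<bar> = q ^ k" using q by simp_all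
    show "q ^ k * (?g (q ^ k) + ?g (- (q ^ k)))
      = q ^ k / q2_prod k * (poly ?f (q ^ k) + poly ?f (- (q ^ k))) * inverse (2 * qpoch_inf q (- q) * ((1 - q) * ?h))"
      unfolding g[OF a(1)] g[OF a(2)] by (simp only: divide_inverse inverse_mult_distrib distrib_left distrib_right mult_ac)
  qed
  also have "(1 - q) * suminf \<dots> = jackson_functional ?f / ?h"
    unfolding suminf_mult2[OF jackson_summable, symmetric] jackson_functional_def
    using q by (simp add: divide_simps)
  also have "\<dots> = (1 - q) ^ p * positive_sum q p j"
    unfolding jackson.moment_qHermite h[symmetric] using \<open>jackson.h j \<noteq> 0\<close> by simp
  finally show ?thesis using q by (simp add: dq_moment_hat_def)
qed

end

section \<open>The Gaussian functional and the limit\<close>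

definition gauss_functional :: "real poly \<Rightarrow> real" where
  "gauss_functional f = (LINT x|lborel. std_normal_density x * poly f x)"

lemma gauss_power:
  "integrable lborel (\<lambda>x. std_normal_density x * x ^ n)"
  "gauss_functional ([:0, 1:] ^ n) = (if even n then fact n / (2 ^ (n div 2) * fact (n div 2)) else 0)"
proof -
  have "has_bochner_integral lborel (\<lambda>x. std_normal_density x * x ^ n)
    (if even n then fact n / (2 ^ (n div 2) * fact (n div 2)) else 0)"
  proof (cases "even n")
    case True
    then obtain k where "n = 2 * k" by (rule evenE)
    then show ?thesis using std_normal_moment_even[of k] by simp
  next
    case False
    then obtain k where "n = 2 * k + 1" by (rule oddE)
    then show ?thesis using std_normal_moment_odd[of k] by simp
  qed
  then show "integrable lborel (\<lambda>x. std_normal_density x * x ^ n)"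
    "gauss_functional ([:0, 1:] ^ n) = (if even n then fact n / (2 ^ (n div 2) * fact (n div 2)) else 0)"
    by (simp_all add: has_bochner_integral_iff gauss_functional_def poly_power)
qed

lemma gauss_integrable: "integrable lborel (\<lambda>x. std_normal_density x * poly f x)"
proof -
  have "(\<lambda>x. std_normal_density x * poly f x) = (\<lambda>x. \<Sum>i\<le>degree f. coeff f i * (std_normal_density x * x ^ i))"
    by (simp add: poly_altdef sum_distrib_left mult_ac)
  then show ?thesis by (simp add: gauss_power)
qed

interpretation gauss: Hermite_functional 1 1 gauss_functional
proof
  show "gauss_functional (f + g) = gauss_functional f + gauss_functional g" for f g
    using gauss_integrable[of f] gauss_integrable[of g] by (simp add: gauss_functional_def distrib_left)
  show "gauss_functional (smult a f) = a * gauss_functional f" for a f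
    by (simp add: gauss_functional_def mult.left_commute[of _ a])
  show "gauss_functional 1 = 1" using gauss_power(2)[of 0] by simp
  show "gauss_functional [:0, 1:] = 0" using gauss_power(2)[of 1] by simp
  show "gauss_functional ([:0, 1:] ^ Suc (Suc n)) = 1 * qint 1 (Suc n) * gauss_functional ([:0, 1:] ^ n)" for n
  proof (cases "even n")
    case True
    then obtain k where n: "n = 2 * k" by (rule evenE)
    \<comment> \<open>\<open>c\<close> is n + 2, the factor common to (n+2)! and to the new
      denominator; n + 1 is what remains.\<close>
    define c where "c = real (2 * Suc k)"
    have "c \<noteq> 0" by (simp add: c_def)
    have "(fact (Suc (Suc n)) :: real) = c * (real (Suc n) * fact n)"
      by (simp add: n c_def algebra_simps)
    moreover have "(2 ^ (Suc (Suc n) div 2) * fact (Suc (Suc n) div 2) :: real) = c * (2 ^ (n div 2) * fact (n div 2))"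
      by (simp add: n c_def algebra_simps)
    ultimately show ?thesis
      using True unfolding gauss_power(2) qint_one
      by (simp only: even_Suc if_True not_not mult_divide_mult_cancel_left[OF \<open>c \<noteq> 0\<close>] times_divide_eq_right mult_1_left)
  qed (simp add: gauss_power(2) del: power_Suc)
qed simp

lemma gauss_h: "gauss.h n = fact n"
  unfolding gauss.h_def by (induction n) (simp_all add: qint_one)

lemma std_normal_density_eq: "std_normal_density x = exp (- (x\<^sup>2) / 2) / sqrt (2 * pi)"
  by (simp add: std_normal_density_def)

lemma gauss_functional_mult:
  "(LINT x|lborel. poly f x * poly g x * exp (- (x\<^sup>2) / 2)) = sqrt (2 * pi) * gauss_functional (f * g)"
proof -
  have "poly f x * poly g x * exp (- (x\<^sup>2) / 2) = sqrt (2 * pi) * (std_normal_density x * poly (f * g) x)" for x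
    by (simp add: std_normal_density_eq)
  then show ?thesis by (simp only: gauss_functional_def integral_mult_right_zero)
qed

section \<open>Uniqueness of the monic Hermite polynomials\<close>

lemma is_monic_Hermite_iff:
  "is_monic_Hermite P \<longleftrightarrow> (\<forall>n. degree (P n) = n \<and> lead_coeff (P n) = 1) \<and>
     (\<forall>m n. m \<noteq> n \<longrightarrow> gauss_functional (P m * P n) = 0)"
  unfolding is_monic_Hermite_def gauss_functional_mult by simp

lemma is_monic_HermiteD:
  assumes "is_monic_Hermite P"
  shows "degree (P n) = n" "coeff (P n) n = 1"
proof -
  have "degree (P n) = n \<and> lead_coeff (P n) = 1"
    using assms unfolding is_monic_Hermite_iff by blast
  then show "degree (P n) = n" "coeff (P n) n = 1" by auto
qed

text \<open>Subtracting the right multiple of the family member of equal degree lowers the degree,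
  so the family spans.\<close>

lemma orthogonal_lower_degree:
  assumes "is_monic_Hermite P"
  shows "degree f < n \<Longrightarrow> gauss_functional (f * P n) = 0"
proof (induction "degree f" arbitrary: f rule: less_induct)
  case less
  define d where "d = degree f"
  note P = is_monic_HermiteD[OF assms, of d]
  have orth: "gauss_functional (P d * P n) = 0"
    using assms less.prems by (auto simp: is_monic_Hermite_iff d_def)
  define g where "g = f - smult (lead_coeff f) (P d)"
  have "gauss_functional (g * P n) = 0"
  proof (cases "g = 0")
    case False
    have "degree g \<le> d" unfolding g_def
      by (rule degree_diff_le) (use P in \<open>auto simp: d_def intro: order.trans[OF degree_smult_le]\<close>)
    moreover have "coeff g d = 0" using P by (simp add: g_def d_def)
    ultimately have "degree g < d" using False by (metis eq_zero_or_degree_less)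
    then show ?thesis using less.hyps[of g] less.prems d_def by simp
  qed simp
  moreover have "f * P n = g * P n + smult (lead_coeff f) (P d * P n)"
    by (simp add: g_def algebra_simps)
  ultimately show ?case using orth by (simp add: gauss.add gauss.scale)
qed

text \<open>The definite description calls for uniqueness. Two monic candidates of degree n differ
  by a polynomial of some degree d < n; pairing it with H_d gives d! times its leading coefficient,
  whereas orthogonality to lower degrees gives 0.\<close>

lemma He_eq_qHermite: "He = qHermite 1 1"
  unfolding He_def
proof (rule the_equality)
  show H: "is_monic_Hermite (qHermite 1 1)"
    by (simp add: is_monic_Hermite_iff degree_qHermite lead_coeff_qHermite[unfolded degree_qHermite] gauss.qHermite_orthogonal)
  fix P assume P: "is_monic_Hermite P"
  show "P = qHermite 1 1"
  proof
    fix n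
    let ?D = "P n - qHermite 1 1 n"
    note Pn = is_monic_HermiteD[OF P, of n]
    have Hn: "degree (qHermite 1 1 n) = n" "coeff (qHermite 1 1 n) n = 1"
      using lead_coeff_qHermite[of 1 1 n] by (simp_all add: degree_qHermite)
    show "P n = qHermite 1 1 n"
    proof (rule ccontr)
      assume ne: "P n \<noteq> qHermite 1 1 n"
      have "degree ?D \<le> n" using Pn Hn by (intro degree_diff_le) auto
      moreover have "coeff ?D n = 0" using Pn Hn by simp
      ultimately have less: "degree ?D < n" using ne by (metis eq_zero_or_degree_less right_minus_eq)
      let ?K = "qHermite 1 1 (degree ?D)"
      have "gauss_functional (?K * P n) = 0" "gauss_functional (?K * qHermite 1 1 n) = 0"
        using orthogonal_lower_degree[OF P, of ?K n] orthogonal_lower_degree[OF H, of ?K n] less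
        by (simp_all add: degree_qHermite)
      then have "gauss_functional (?D * ?K) = 0"
        by (simp add: gauss.diff mult.commute[of _ ?K] right_diff_distrib)
      moreover have "gauss_functional (?D * ?K) = lead_coeff ?D * fact (degree ?D)"
        using gauss.mult_qHermite[of ?D "degree ?D"] by (simp add: gauss_h)
      moreover have "?D \<noteq> 0" using ne by simp
      then have "lead_coeff ?D \<noteq> 0" by (simp only: leading_coeff_0_iff not_False_eq_True)
      ultimately show False by (metis fact_nonzero mult_eq_0_iff)
    qed
  qed
qed

lemma gue_moment_eq_positive_sum: "gue_moment p j = positive_sum 1 p j"
proof -
  have "x ^ (2 * p) * ((poly (He j) x)\<^sup>2 / fact j) * (exp (- (x\<^sup>2) / 2) / sqrt (2 * pi))
    = std_normal_density x * poly ([:0, 1:] ^ (2 * p) * (qHermite 1 1 j)\<^sup>2) x / fact j" for x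
    by (simp add: He_eq_qHermite std_normal_density_eq poly_power mult_ac)
  then have "gue_moment p j = gauss_functional ([:0, 1:] ^ (2 * p) * (qHermite 1 1 j)\<^sup>2) / fact j"
    by (simp add: gue_moment_def gauss_functional_def)
  then show ?thesis by (simp add: gauss.moment_qHermite gauss_h)
qed

text \<open>Summation over j divides the generating function by 1 - z, up to a shift; the factor 1 -
  z^2 of (z^2;q^2)_p leaves 1 + z, hence the two binomials and p - 1. The proof telescopes: the
  Pascal rule in base q^2 turns the alternating sum at j = N into the increment of the right
  side.\<close>

lemma positive_sum_sum_eq_alternating:
  assumes "q > 0" "p \<ge> 1"
  shows "(\<Sum>j<N. positive_sum q p j) = qdfac_odd q p * (\<Sum>r\<le>p - 1. (- 1) ^ r * q ^ (r * (r + 1)) *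
     (gbin q (N + 2 * p - 2 * r - 1) (2 * p) + gbin q (N + 2 * p - 2 * r - 2) (2 * p)) * gbin (q\<^sup>2) (p - 1) r)"
    (is "_ = _ * ?A N")
proof (induction N)
  case 0
  \<comment> \<open>For N = 0 both upper indices lie below 2p.\<close>
  have "?A 0 = 0" using assms(2) by (intro sum.neutral ballI) (auto simp: gbin_eq_0)
  then show ?case by simp
next
  case (Suc N)
  obtain p' where [simp]: "p = Suc p'" using assms(2) by (cases p) auto
  let ?B = "\<lambda>n. gbin q n (2 * p)"
  let ?g = "gbin (q\<^sup>2) p'"
  let ?c = "\<lambda>r. (- 1) ^ r * q ^ (r * (r + 1))"
  \<comment> \<open>The part of the Pascal split that carries q^(2r); the other part, shifted by one
    in r, is the subtracted sum.\<close>
  define t where "t r = (- 1) ^ r * q ^ (r * (r - 1)) * ?B (N + 2 * p - 2 * r) * (q\<^sup>2) ^ r * ?g r" for r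
  have "(\<Sum>r\<le>p. (- 1) ^ r * q ^ (r * (r - 1)) * ?B (N + 2 * p - 2 * r) * gbin (q\<^sup>2) p r)
    = t 0 + (\<Sum>r\<le>p'. t (Suc r) - ?c r * ?B (N + 2 * p - 2 * Suc r) * ?g r)"
    unfolding \<open>p = Suc p'\<close> sum.atMost_Suc_shift
    by (intro arg_cong2[of _ _ _ _ "(+)"] sum.cong) (simp_all add: t_def algebra_simps)
  also have "\<dots> = (\<Sum>r\<le>Suc p'. t r) - (\<Sum>r\<le>p'. ?c r * ?B (N + 2 * p - 2 * Suc r) * ?g r)"
    unfolding sum.atMost_Suc_shift sum_subtractf by simp
  also have "(\<Sum>r\<le>Suc p'. t r) = (\<Sum>r\<le>p'. ?c r * ?B (N + 2 * p - 2 * r) * ?g r)"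
  proof -
    have "t r = ?c r * ?B (N + 2 * p - 2 * r) * ?g r" for r
    proof -
      have "r * (r - 1) + 2 * r = r * (r + 1)" by (cases r) simp_all
      then have "q ^ (r * (r - 1)) * (q\<^sup>2) ^ r = q ^ (r * (r + 1))"
        by (simp only: power_mult[symmetric] power_add[symmetric])
      moreover have "t r = (- 1) ^ r * (q ^ (r * (r - 1)) * (q\<^sup>2) ^ r) * ?B (N + 2 * p - 2 * r) * ?g r"
        unfolding t_def by (simp only: mult_ac)
      ultimately show ?thesis by (simp only:)
    qed
    then show ?thesis by (simp add: gbin_eq_0)
  qed
  \<comment> \<open>The binomials with upper index N + 2p - 2r - 1 occur in both brackets and
    cancel.\<close>
  also have "(\<Sum>r\<le>p'. ?c r * ?B (N + 2 * p - 2 * r) * ?g r) - (\<Sum>r\<le>p'. ?c r * ?B (N + 2 * p - 2 * Suc r) * ?g r)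
    = ?A (Suc N) - ?A N"
    unfolding sum_subtractf[symmetric]
  proof (intro sum.cong)
    fix r assume "r \<in> {..p - 1}"
    then have e: "N + 2 * p - 2 * Suc r = N + 2 * p - 2 * r - 2"
      "Suc N + 2 * p - 2 * r - 1 = N + 2 * p - 2 * r" "Suc N + 2 * p - 2 * r - 2 = N + 2 * p - 2 * r - 1"
      by auto
    show "?c r * ?B (N + 2 * p - 2 * r) * ?g r - ?c r * ?B (N + 2 * p - 2 * Suc r) * ?g r
      = ?c r * (?B (Suc N + 2 * p - 2 * r - 1) + ?B (Suc N + 2 * p - 2 * r - 2)) * gbin (q\<^sup>2) (p - 1) r
        - ?c r * (?B (N + 2 * p - 2 * r - 1) + ?B (N + 2 * p - 2 * r - 2)) * gbin (q\<^sup>2) (p - 1) r"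
      unfolding e by (simp add: algebra_simps)
  qed simp
  finally have "positive_sum q p N = qdfac_odd q p * (?A (Suc N) - ?A N)"
    unfolding positive_sum_eq_alternating_sum[OF assms(1)] alternating_sum_def by (rule arg_cong)
  then show ?case
    unfolding sum.lessThan_Suc Suc.IH by (simp only: right_diff_distrib add_diff_eq add_diff_cancel_left')
qed

section \<open>Values at q = 1\<close>

lemma dfact_odd_eq: "real (dfact_odd n) = qdfac_odd 1 n"
  unfolding dfact_odd_def by (induction n) (simp_all add: qint_one algebra_simps)

text \<open>Here (2p)! = (2p-1)!! 2^p p!, and division by 2^(p-l) (p-l)! l! leaves 2^l times a
  binomial coefficient.\<close>

lemma positive_sum_1: "positive_sum 1 p j = real (dfact_odd p) * (\<Sum>l\<le>p. real (j choose l) * real (p choose l) * 2 ^ l)"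
proof -
  have fac: "qfac 1 n = (fact n :: real)" for n
    by (induction n) (simp_all add: qint_one)
  have even: "qdfac_even 1 n = (2 ^ n * fact n :: real)" for n
    by (induction n) (simp_all add: qint_one)
  have "qfac 1 (2 * p) / (qdfac_even 1 (p - l) * qfac 1 l) = qdfac_odd 1 p * (real (p choose l) * 2 ^ l)"
    if "l \<le> p" for l
  proof -
    have "(2::real) ^ p = 2 ^ (p - l) * 2 ^ l" using that by (simp flip: power_add)
    then show ?thesis
      unfolding qfac_double fac even binomial_fact[OF that] by (simp add: field_simps)
  qed
  then show ?thesis
    by (simp add: positive_sum_def gbin_one dfact_odd_eq sum_distrib_left mult_ac)
qed

text \<open>After exchange of the sums, the hockey-stick identity raises the lower index to l +
  1.\<close>

lemma sum_positive_sum_1: "(\<Sum>j<N. positive_sum 1 p j) = real (dfact_odd p) * (\<Sum>l\<le>p. real (N choose (l + 1)) * real (p choose l) * 2 ^ l)"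
proof -
  have hockey: "(\<Sum>j<N. real (j choose l)) = real (N choose Suc l)" for l
    by (induction N) simp_all
  have "(\<Sum>j<N. positive_sum 1 p j) = real (dfact_odd p) * (\<Sum>l\<le>p. \<Sum>j<N. real (j choose l) * (real (p choose l) * 2 ^ l))"
    unfolding positive_sum_1 sum_distrib_left[symmetric] by (subst sum.swap) (simp add: mult.assoc)
  then show ?thesis unfolding sum_distrib_right[symmetric] hockey by (simp add: mult.assoc)
qed

section \<open>Continuity in q and the limit\<close>

lemma isCont_qint: "isCont (\<lambda>q::real. qint q n) x"
  unfolding qint_def by (intro continuous_intros)

lemma isCont_gbin: "isCont (\<lambda>q::real. gbin q n k) x"
proof (induction x n k rule: gbin.induct)
  case (3 x n k)
  then show ?case unfolding gbin.simps by (intro isCont_add isCont_mult isCont_power continuous_ident)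
qed simp_all

lemma isCont_positive_sum:
  assumes "x > 0"
  shows "isCont (\<lambda>q. positive_sum q p j) x"
proof -
  have fac: "isCont (\<lambda>q. qfac q n) x" "isCont (\<lambda>q. qdfac_even q n) x" for n
    unfolding qfac_def qdfac_even_def by (intro continuous_intros isCont_qint)+
  have "qdfac_even x n * qfac x m \<noteq> 0" for m n
    using qdfac_even_pos[OF assms, of n] qfac_pos[OF assms, of m] by simp
  then show ?thesis
    unfolding positive_sum_def by (intro continuous_intros isCont_gbin fac)
qed

theorem theorem2p1:
  fixes p j N :: nat
  assumes "N \<ge> 1"
  shows
    "(let S = (\<lambda>q::real. \<Sum>l=0..p.
                q powi ((int j - int l) * (2 * int p - int l) + int l * (int l - 1) div 2)
                * qbinom q j l * (qfact q (2 * p) / (qdfact_even q (p - l) * qfact q l)));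
          L = real (dfact_odd p) * (\<Sum>l=0..p. real (j choose l) * real (p choose l) * 2 ^ l)
      in (\<forall>q. 0 < q \<and> q < 1 \<longrightarrow> dq_moment_hat q p j = S q)
         \<and> (S \<longlongrightarrow> L) (at_left 1)
         \<and> gue_moment p j = L
         \<and> ((\<lambda>q. dq_moment_hat q p j) \<longlongrightarrow> gue_moment p j) (at_left 1))
     \<and>
     (let S = (\<lambda>q::real. \<Sum>i=0..N-1. \<Sum>l=0..p.
                q powi ((int i - int l) * (2 * int p - int l) + int l * (int l - 1) div 2)
                * qbinom q i l * (qfact q (2 * p) / (qdfact_even q (p - l) * qfact q l)));
          L = real (dfact_odd p) * (\<Sum>l=0..p. real (N choose (l + 1)) * real (p choose l) * 2 ^ l)
      in (\<forall>q. 0 < q \<and> q < 1 \<longrightarrow> dq_moment_hat_sum q N p = S q)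
         \<and> (S \<longlongrightarrow> L) (at_left 1)
         \<and> gue_moment_sum N p = L
         \<and> ((\<lambda>q. dq_moment_hat_sum q N p) \<longlongrightarrow> gue_moment_sum N p) (at_left 1))
     \<and>
     (let S = (\<lambda>q::real. qdfact_odd q p * (\<Sum>r=0..p.
                (-1) ^ r * q ^ (r * (r - 1)) * qbinom q (j + 2 * p - 2 * r) (2 * p)
                * qbinom (q\<^sup>2) p r));
          L = real (dfact_odd p) * (\<Sum>r=0..p.
                (-1) ^ r * real ((j + 2 * p - 2 * r) choose (2 * p)) * real (p choose r))
      in (\<forall>q. 0 < q \<and> q < 1 \<longrightarrow> dq_moment_hat q p j = S q)
         \<and> (S \<longlongrightarrow> L) (at_left 1)
         \<and> gue_moment p j = L)
     \<and>
     (p \<ge> 1 \<longrightarrow>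
      (let S = (\<lambda>q::real. qdfact_odd q p * (\<Sum>r=0..p-1.
                 (-1) ^ r * q ^ (r * (r + 1))
                 * (qbinom q (N + 2 * p - 2 * r - 1) (2 * p)
                    + qbinom q (N + 2 * p - 2 * r - 2) (2 * p))
                 * qbinom (q\<^sup>2) (p - 1) r));
           L = real (dfact_odd p) * (\<Sum>r=0..p-1.
                 (-1) ^ r * (real ((N + 2 * p - 2 * r - 1) choose (2 * p))
                             + real ((N + 2 * p - 2 * r - 2) choose (2 * p)))
                 * real ((p - 1) choose r))
       in (\<forall>q. 0 < q \<and> q < 1 \<longrightarrow> dq_moment_hat_sum q N p = S q)
          \<and> (S \<longlongrightarrow> L) (at_left 1)
          \<and> gue_moment_sum N p = L))"
proof -
  let ?C = "\<lambda>q::real. 0 < q \<and> q < 1"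
  let ?S1 = "\<lambda>j (q::real). \<Sum>l=0..p.
                q powi ((int j - int l) * (2 * int p - int l) + int l * (int l - 1) div 2)
                * qbinom q j l * (qfact q (2 * p) / (qdfact_even q (p - l) * qfact q l))"
  let ?S3 = "\<lambda>q::real. qdfact_odd q p * (\<Sum>r=0..p.
                (-1) ^ r * q ^ (r * (r - 1)) * qbinom q (j + 2 * p - 2 * r) (2 * p)
                * qbinom (q\<^sup>2) p r)"
  let ?S4 = "\<lambda>q::real. qdfact_odd q p * (\<Sum>r=0..p-1.
                 (-1) ^ r * q ^ (r * (r + 1))
                 * (qbinom q (N + 2 * p - 2 * r - 1) (2 * p)
                    + qbinom q (N + 2 * p - 2 * r - 2) (2 * p))
                 * qbinom (q\<^sup>2) (p - 1) r)"
  have hat: "dq_moment_hat q p i = positive_sum q p i" if "?C q" for q i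
    using that by (simp add: q_unit_interval.dq_moment_hat_eq_positive_sum q_unit_interval_def)
  then have hat_sum: "dq_moment_hat_sum q N p = (\<Sum>i<N. positive_sum q p i)" if "?C q" for q
    using that by (simp add: dq_moment_hat_sum_def)
  have gue_sum: "gue_moment_sum N p = (\<Sum>i<N. positive_sum 1 p i)"
    by (simp add: gue_moment_sum_def gue_moment_eq_positive_sum)
  \<comment> \<open>At \<open>q = 1\<close> the sums of the statement are built from 0 / 0, so the
    limit is read off from a function \<open>g\<close> that is continuous at 1 and agrees with them
    on (0,1).\<close>
  have lim: "(f \<longlongrightarrow> l) (at_left 1)" if "isCont g 1" "l = g 1" "\<And>q. ?C q \<Longrightarrow> f q = g q" for f g :: "real \<Rightarrow> real" and l
  proof -
    have "(g \<longlongrightarrow> l) (at_left 1)"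
      using that(1,2) unfolding continuous_within by (rule_tac tendsto_within_subset[where S = UNIV]) auto
    moreover have "eventually (\<lambda>q. f q = g q) (at_left 1)"
      using that(3) by (auto simp: eventually_at_left_field intro!: exI[of _ 0])
    ultimately show ?thesis by (simp add: tendsto_cong)
  qed
  have cont: "isCont (\<lambda>q. positive_sum q p j) 1" "isCont (\<lambda>q. \<Sum>i<N. positive_sum q p i) 1"
    by (auto intro!: continuous_intros isCont_positive_sum)
  have S1: "?S1 i q = positive_sum q p i" if "?C q" for q i
    unfolding positive_sum_def atLeast0AtMost
  proof (intro sum.cong refl)
    fix l assume "l \<in> {..p}"
    then have l: "l \<le> p" by simp
    show "q powi ((int i - int l) * (2 * int p - int l) + int l * (int l - 1) div 2)
        * qbinom q i l * (qfact q (2 * p) / (qdfact_even q (p - l) * qfact q l))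
      = q ^ ((i - l) * (2 * p - l) + l * (l - 1) div 2) * gbin q i l * (qfac q (2 * p) / (qdfac_even q (p - l) * qfac q l))"
    \<comment> \<open>For l > i the integer exponent may be negative and differ from the truncated
      one, but the q-binomial makes both sides 0.\<close>
    proof (cases "l \<le> i")
      case True
      have "int l * (int l - 1) div 2 = int (l * (l - 1) div 2)"
        by (cases l) (simp_all add: zdiv_int algebra_simps)
      moreover have "int i - int l = int (i - l)" "2 * int p - int l = int (2 * p - l)"
        using l True by simp_all
      ultimately have "(int i - int l) * (2 * int p - int l) + int l * (int l - 1) div 2
        = int ((i - l) * (2 * p - l) + l * (l - 1) div 2)"
        by (simp only: of_nat_add of_nat_mult)
      then show ?thesis
        using that by (simp add: qbinom_eq_gbin qfact_eq_qfac qdfact_even_eq_qdfac_even del: of_nat_add of_nat_mult)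
    qed (use that in \<open>simp add: qbinom_eq_gbin gbin_eq_0\<close>)
  qed
  \<comment> \<open>This needs N \<ge> 1: for N = 0 the truncated range would still contain
    0.\<close>
  have "{0..N - 1} = {..<N}" using assms by auto
  then have S2: "(\<Sum>i=0..N-1. ?S1 i q) = (\<Sum>i<N. positive_sum q p i)" if "?C q" for q
    using S1[OF that] by simp
  have sq: "0 < q\<^sup>2" "q\<^sup>2 \<noteq> 1" "q \<noteq> 1" if "?C q" for q :: real
    using that by (auto simp: power2_eq_1_iff)
  have S3: "?S3 q = positive_sum q p j" if "?C q" for q
    using that sq[OF that] by (simp add: positive_sum_eq_alternating_sum alternating_sum_def atLeast0AtMost qdfact_odd_eq_qdfac_odd qbinom_eq_gbin)
  have S4: "?S4 q = (\<Sum>i<N. positive_sum q p i)" if "?C q" "p \<ge> 1" for q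
    using that sq[OF that(1)] by (simp add: positive_sum_sum_eq_alternating atLeast0AtMost qdfact_odd_eq_qdfac_odd qbinom_eq_gbin)
  have L1: "positive_sum 1 p j = real (dfact_odd p) * (\<Sum>l=0..p. real (j choose l) * real (p choose l) * 2 ^ l)"
    by (simp only: positive_sum_1 atLeast0AtMost)
  have L2: "(\<Sum>i<N. positive_sum 1 p i) = real (dfact_odd p) * (\<Sum>l=0..p. real (N choose (l + 1)) * real (p choose l) * 2 ^ l)"
    by (simp only: sum_positive_sum_1 atLeast0AtMost)
  have L3: "positive_sum 1 p j = real (dfact_odd p) * (\<Sum>r=0..p.
                (-1) ^ r * real ((j + 2 * p - 2 * r) choose (2 * p)) * real (p choose r))"
    by (simp add: positive_sum_eq_alternating_sum alternating_sum_def dfact_odd_eq gbin_one atLeast0AtMost)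
  have L4: "(\<Sum>i<N. positive_sum 1 p i) = real (dfact_odd p) * (\<Sum>r=0..p-1.
                 (-1) ^ r * (real ((N + 2 * p - 2 * r - 1) choose (2 * p))
                             + real ((N + 2 * p - 2 * r - 2) choose (2 * p)))
                 * real ((p - 1) choose r))" if "p \<ge> 1"
    using that by (simp add: positive_sum_sum_eq_alternating dfact_odd_eq gbin_one atLeast0AtMost)
  show ?thesis
    unfolding Let_def
  proof (intro conjI allI impI, goal_cases)
    case (1 q)
    then show ?case by (simp only: hat S1)
  next
    case 2
    show ?case unfolding L1[symmetric] by (rule lim[OF cont(1) refl S1])
  next
    case 3
    show ?case by (simp only: gue_moment_eq_positive_sum L1)
  next
    case 4
    show ?case unfolding gue_moment_eq_positive_sum by (rule lim[OF cont(1) refl hat])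
  next
    case (5 q)
    then show ?case by (simp only: hat_sum S2)
  next
    case 6
    show ?case unfolding L2[symmetric] by (rule lim[OF cont(2) refl S2])
  next
    case 7
    show ?case by (simp only: gue_sum L2)
  next
    case 8
    show ?case unfolding gue_sum by (rule lim[OF cont(2) refl hat_sum])
  next
    case (9 q)
    then show ?case by (simp only: hat S3)
  next
    case 10
    show ?case unfolding L3[symmetric] by (rule lim[OF cont(1) refl S3])
  next
    case 11
    show ?case by (simp only: gue_moment_eq_positive_sum L3)
  next
    case (12 q)
    then show ?case by (simp only: hat_sum S4)
  next
    case 13
    then show ?case unfolding L4[OF 13, symmetric] by (intro lim[OF cont(2) refl S4])
  next
    case 14
    then show ?case by (simp only: gue_sum L4)
  qed
qed

end
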